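(* A vector bundle with a level structure $(E,f)$ is $\delta_2$-semistable (respectively $\delta_2$-stable) if and only if every non-trivial proper subbundle $F\subset E$ satisfies \[ \deg(F)\,r \;\le\; \deg(E)\,\mathrm{rk}(F)+r\,\delta_2\sum_{s\in\{r_1,\dots,r_{k+1}\}}\Bigl(q\bigl(s_-+\dim(\overline{W}_{j_-(s)}/\overline{W}_{j^+(s)})\bigr)-q(s_-)\Bigr) \] (respectively the same with $<$ in place of $\le$), where $\overline{W}_j:=F_{|\{x_0\}}\cap W_j$ and $q(t):=\sum_{1\le i\le t}\theta_i\, i+\sum_{t<i\le r}\theta_i\, t-\frac{t}{r}\sum_{i=1}^r\theta_i\, i$.
   Context: $X$ is a smooth projective curve over $\mathbb{C}$, $x_0\in X$ a fixed point, $r\ge1$, $\delta_2\in\mathbb{Q}_{>0}$, and $\theta_1,\dots,\theta_r$ are fixed positive integers. Complete homomorphisms. For a vector space $V$ of dimension $r$ let $H=\prod_{i=1}^r(\mathrm{Hom}(\bigwedge^iV,\bigwedge^i\mathbb{C}^r)\setminus\{0\})$ and $\Omega'\subset H\times\mathbb{C}^{r-1}$ the set of $((f_i),(l_i))$ with all $l_i\neq0$ and $\bigwedge^if_1=\bigl(\prod_{j=1}^{i-1}l_j^{i-j}\bigr)f_i$ for $1\le i\le r$. The closure $\Omega$ of $\Omega'$ in $H\times\mathbb{C}^{r-1}$ is the space of complete (completed) homomorphisms $f:V\Rightarrow\mathbb{C}^r$. It is the disjoint union of strata indexed by sequences $0<r_1<\dots<r_k<r_{k+1}=r$, the stratum being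 given by: for $1\le i\le r-1$, $l_i=0$ iff $i\in\{r_1,\dots,r_k\}$. A point of this stratum is uniquely determined by the tuple $(l_1,\dots,l_{r-1})$, a descending flag $V=W_0\supset W_1\supset\dots\supset W_k\supset W_{k+1}=0$ with $\dim W_j=r-r_j$, an ascending flag $0=W'_0\subset W'_1\subset\dots\subset W'_k\subset W'_{k+1}=\mathbb{C}^r$ with $\dim W'_j=r_j$, and isomorphisms $v_j:W_{j-1}/W_j\to W'_j/W'_{j-1}$ ($1\le j\le k+1$), as follows. Put $r_0=0$ and, for $1\le i\le r$, $j_-(i)=\max\{j\in\{0,\dots,k\}:r_j<i\}$, $i_-=r_{j_-(i)}$, $j^+(i)=\min\{j\in\{0,\dots,k+1\}:i\le r_j\}$, $i^+=r_{j^+(i)}$. Let $h_i:\bigwedge^iV\to\bigwedge^i\mathbb{C}^r$ be the composition of the natural surjection onto $\bigwedge^{i-i_-}(W_{j_-(i)}/W_{j^+(i)})\otimes\bigotimes_{j=1}^{j_-(i)}\bigwedge^{r_j-r_{j-1}}(W_{j-1}/W_j)$, the isomorphism induced by the $v_j$ onto $\bigwedge^{i-i_-}(W'_{j^+(i)}/W'_{j_-(i)})\otimes\bigotimes_{j=1}^{j_-(i)}\bigwedge^{r_j-r_{j-1}}(W'_j/W'_{j-1})$, and the natural injection into $\bigwedge^i\mathbb{C}^r$. Then $f_i=\bigl(\prod_{1\le j<i,\,j\notin\{r_1,\dots,r_k\}}l_j^{i-j}\bigr)h_i$. A vector bundle with a level structure is a pair $(E,f)$ with $E$ a vector bundle of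 rank $r$ on $X$ and $f:E_{|\{x_0\}}\Rightarrow\mathbb{C}^r$ a complete homomorphism; $r_1<\dots<r_{k+1}$ and $W_\bullet$ (a descending flag of $V=E_{|\{x_0\}}$) denote the data determined by $f$. As a decorated vector bundle, $(E,f)$ is considered through the point $([f_1],\dots,[f_r])=([h_1],\dots,[h_r])$, i.e. up to the action of $(\mathbb{C}^* )^r$ on $\Omega$ whose quotient is the wonderful compactification of $\mathrm{PGL}(r,\mathbb{C})$, linearized by $\mathcal{O}(\theta_1,\dots,\theta_r)$. Stability. A weighted flag $(E_\bullet,\alpha)$ of $E$ is a flag of subbundles $0\subsetneq E_1\subsetneq\dots\subsetneq E_m\subsetneq E_{m+1}=E$, $m\geq 1$, with positive rationals $\alpha_1,\dots,\alpha_m$. Put $\gamma_l=\sum_{j=1}^m\alpha_j\mathrm{rk}(E_j)-r\sum_{j=l}^m\alpha_j$ ($1\le l\le m+1$), $V_l=E_{l|\{x_0\}}$, $\mu(E_\bullet,\alpha,[h_i])=-\min\{\gamma_{l_1}+\dots+\gamma_{l_i}: h_i(V_{l_1}\wedge\dots\wedge V_{l_i})\ne0\}$, $\mu_2(E_\bullet,\alpha,f)=\sum_{i=1}^r\theta_i\,\mu(E_\bullet,\alpha,[h_i])$, and $M(E_\bullet,\alpha)=\sum_j\alpha_j(\deg(E)\mathrm{rk}(E_j)-\deg(E_j)r)$. $(E,f)$ is $\delta_2$-semistable (stable) if $M(E_\bullet,\alpha)+\delta_2\mu_2(E_\bullet,\alpha,f)\ge0$ ($>0$) for every weighted flag.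
   Formalization: The printed relation f_i = (∏ l_j^{i-j}) h_i contradicts the definition of Ω' (e.g. r=2, k=0, l_1=2); the formal statement uses h_i = (∏ l_j^{i-j}) f_i instead, which changes only nonzero scalars, so [f_i]=[h_i] and the flag W are unaffected. *)

theory Defs
  imports "HOL-Analysis.Analysis" "HOL-Combinatorics.Permutations"
begin

section \<open>Smooth projective curves over the complex numbers\<close>

text \<open>A point of projective space is a line through the origin of \<open>complex ^ 'n\<close>, so the ambient
  space has dimension \<open>CARD('n) - 1\<close>, with \<open>'n\<close> arbitrary.\<close>

type_synonym 'n ppoint = "(complex ^ 'n) set"

definition proj_space :: "('n::finite) ppoint set" where
  "proj_space = {L. vec.subspace L \<and> vec.dim L = 1}"

inductive poly_fun :: "(complex ^ ('n::finite) \<Rightarrow> complex) \<Rightarrow> bool" where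
  const: "poly_fun (\<lambda>x. c)"
| coord: "poly_fun (\<lambda>x. x $ i)"
| add: "poly_fun F \<Longrightarrow> poly_fun G \<Longrightarrow> poly_fun (\<lambda>x. F x + G x)"
| mult: "poly_fun F \<Longrightarrow> poly_fun G \<Longrightarrow> poly_fun (\<lambda>x. F x * G x)"

definition homogeneous :: "nat \<Rightarrow> (complex ^ ('n::finite) \<Rightarrow> complex) \<Rightarrow> bool" where
  "homogeneous d F \<longleftrightarrow> poly_fun F \<and> (\<forall>c x. F (c *s x) = c ^ d * F x)"

definition zero_locus :: "(complex ^ ('n::finite) \<Rightarrow> complex) set \<Rightarrow> 'n ppoint set" where
  "zero_locus S = {L \<in> proj_space. \<forall>F\<in>S. \<forall>x\<in>L. F x = 0}"

definition zclosed :: "('n::finite) ppoint set \<Rightarrow> bool" where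
  "zclosed Z \<longleftrightarrow> (\<exists>S. (\<forall>F\<in>S. \<exists>d. homogeneous d F) \<and> Z = zero_locus S)"

definition zirreducible :: "('n::finite) ppoint set \<Rightarrow> bool" where
  "zirreducible Z \<longleftrightarrow> Z \<noteq> {} \<and>
     (\<forall>A B. zclosed A \<longrightarrow> zclosed B \<longrightarrow> Z \<subseteq> A \<union> B \<longrightarrow> Z \<subseteq> A \<or> Z \<subseteq> B)"

definition irr_chain :: "('n::finite) ppoint set \<Rightarrow> nat \<Rightarrow> bool" where
  "irr_chain X n \<longleftrightarrow> (\<exists>Z. (\<forall>i\<le>n. zclosed (Z i) \<and> zirreducible (Z i) \<and> Z i \<subseteq> X) \<and>
     (\<forall>i<n. Z i \<subset> Z (Suc i)))"

definition has_krull_dim :: "('n::finite) ppoint set \<Rightarrow> nat \<Rightarrow> bool" where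
  "has_krull_dim X n \<longleftrightarrow> irr_chain X n \<and> \<not> irr_chain X (Suc n)"

text \<open>The Zariski tangent space at \<open>x\<close> of the affine cone over \<open>X\<close>; for \<open>X\<close> of pure dimension \<open>d\<close>
  it has dimension \<open>d + 1\<close> exactly if \<open>X\<close> is smooth at the point spanned by \<open>x\<close>.\<close>

definition cone_tangent :: "('n::finite) ppoint set \<Rightarrow> complex ^ 'n \<Rightarrow> (complex ^ 'n) set" where
  "cone_tangent X x = {v. \<forall>d F. homogeneous d F \<longrightarrow> (\<forall>L\<in>X. \<forall>y\<in>L. F y = 0) \<longrightarrow>
     deriv (\<lambda>t::complex. F (x + t *s v)) 0 = 0}"

definition smooth_projective_curve :: "('n::finite) ppoint set \<Rightarrow> bool" where
  "smooth_projective_curve X \<longleftrightarrow> zclosed X \<and> zirreducible X \<and> has_krull_dim X 1 \<and>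
     (\<forall>L\<in>X. \<forall>x\<in>L - {0}. vec.dim (cone_tangent X x) = 2)"

definition zopen_in :: "('n::finite) ppoint set \<Rightarrow> 'n ppoint set \<Rightarrow> bool" where
  "zopen_in X U \<longleftrightarrow> U \<subseteq> X \<and> zclosed (X - U)"

definition regular_on ::
  "('n::finite) ppoint set \<Rightarrow> 'n ppoint set \<Rightarrow> ('n ppoint \<Rightarrow> complex) \<Rightarrow> bool" where
  "regular_on X U f \<longleftrightarrow> (\<forall>p\<in>U. \<exists>V d G H. zopen_in X V \<and> p \<in> V \<and> V \<subseteq> U \<and>
     homogeneous d G \<and> homogeneous d H \<and>
     (\<forall>L\<in>V. \<forall>x\<in>L - {0}. H x \<noteq> 0 \<and> f L = G x / H x))"

text \<open>\<open>local_parameter X p U t\<close>: \<open>t\<close> generates the maximal ideal of the local ring of \<open>X\<close> at \<open>p\<close>,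
  and \<open>U\<close> is so small that \<open>t\<close> has no other zero on it.\<close>

definition local_parameter ::
  "('n::finite) ppoint set \<Rightarrow> 'n ppoint \<Rightarrow> 'n ppoint set \<Rightarrow> ('n ppoint \<Rightarrow> complex) \<Rightarrow> bool" where
  "local_parameter X p U t \<longleftrightarrow> zopen_in X U \<and> p \<in> U \<and> regular_on X U t \<and>
     t p = 0 \<and> (\<forall>x\<in>U - {p}. t x \<noteq> 0) \<and>
     (\<forall>V g. zopen_in X V \<longrightarrow> p \<in> V \<longrightarrow> regular_on X V g \<longrightarrow> g p = 0 \<longrightarrow>
        (\<exists>W h. zopen_in X W \<and> p \<in> W \<and> W \<subseteq> U \<inter> V \<and> regular_on X W h \<and>
           (\<forall>x\<in>W. g x = t x * h x)))"

text \<open>The order at \<open>p\<close> of a rational function \<open>f\<close> that is regular on the dense open set \<open>D\<close>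
  (which need not contain \<open>p\<close>).\<close>

definition has_order ::
  "('n::finite) ppoint set \<Rightarrow> 'n ppoint \<Rightarrow> 'n ppoint set \<Rightarrow> ('n ppoint \<Rightarrow> complex) \<Rightarrow> int \<Rightarrow> bool"
  where
  "has_order X p D f n \<longleftrightarrow> (\<exists>U t u. local_parameter X p U t \<and> U - {p} \<subseteq> D \<and>
     regular_on X U u \<and> (\<forall>x\<in>U. u x \<noteq> 0) \<and> (\<forall>x\<in>U - {p}. f x = t x powi n * u x))"


section \<open>Vector bundles, subbundles, degree\<close>

text \<open>A vector bundle is a family of complex vector spaces \<open>fibre E x\<close> (inside one ambient vector
  space with scalar multiplication \<open>smul E\<close>) together with its sheaf of regular sections:
  \<open>regsec E U s\<close> means that \<open>s\<close> restricts to a regular section over \<open>U\<close>.\<close>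

record ('n, 'e) vbundle =
  smul :: "complex \<Rightarrow> 'e \<Rightarrow> 'e"
  fibre :: "(complex ^ 'n) set \<Rightarrow> 'e set"
  regsec :: "(complex ^ 'n) set set \<Rightarrow> ((complex ^ 'n) set \<Rightarrow> 'e) \<Rightarrow> bool"

definition local_frame ::
  "('n::finite) ppoint set \<Rightarrow> nat \<Rightarrow> ('n, 'e::ab_group_add) vbundle \<Rightarrow> 'n ppoint set \<Rightarrow>
   (nat \<Rightarrow> 'n ppoint \<Rightarrow> 'e) \<Rightarrow> bool" where
  "local_frame X m E U e \<longleftrightarrow> zopen_in X U \<and>
     (\<forall>x\<in>U. inj_on (\<lambda>i. e i x) {..<m} \<and>
        \<not> module.dependent (smul E) ((\<lambda>i. e i x) ` {..<m}) \<and>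
        module.span (smul E) ((\<lambda>i. e i x) ` {..<m}) = fibre E x) \<and>
     (\<forall>V s. zopen_in X V \<longrightarrow> V \<subseteq> U \<longrightarrow>
        (regsec E V s \<longleftrightarrow>
          (\<exists>a. (\<forall>i<m. regular_on X V (a i)) \<and>
               (\<forall>x\<in>V. s x = (\<Sum>i<m. smul E (a i x) (e i x))))))"

definition vector_bundle ::
  "('n::finite) ppoint set \<Rightarrow> nat \<Rightarrow> ('n, 'e::ab_group_add) vbundle \<Rightarrow> bool" where
  "vector_bundle X m E \<longleftrightarrow> vector_space (smul E) \<and>
     (\<forall>x\<in>X. module.subspace (smul E) (fibre E x)) \<and>
     (\<forall>U s. zopen_in X U \<longrightarrow>
        (regsec E U s \<longleftrightarrow>
          (\<forall>p\<in>U. \<exists>V. zopen_in X V \<and> p \<in> V \<and> V \<subseteq> U \<and> regsec E V s))) \<and>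
     (\<forall>p\<in>X. \<exists>U e. p \<in> U \<and> local_frame X m E U e)"

text \<open>The bundle carried by a family \<open>F\<close> of subspaces of the fibres of \<open>E\<close>: its sections are the
  sections of \<open>E\<close> with values in \<open>F\<close>.\<close>

definition restrict_bundle ::
  "('n, 'e) vbundle \<Rightarrow> ((complex ^ 'n) set \<Rightarrow> 'e set) \<Rightarrow> ('n, 'e) vbundle" where
  "restrict_bundle E F =
     E\<lparr>fibre := F, regsec := (\<lambda>U s. regsec E U s \<and> (\<forall>x\<in>U. s x \<in> F x))\<rparr>"

text \<open>Local frames of \<open>F\<close> are fibrewise linearly independent in \<open>E\<close>, so this is the notion of a
  subbundle with locally free quotient, not merely of a locally free subsheaf.\<close>

definition subbundle ::
  "('n::finite) ppoint set \<Rightarrow> ('n, 'e::ab_group_add) vbundle \<Rightarrow> ('n ppoint \<Rightarrow> 'e set) \<Rightarrow> bool" where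
  "subbundle X E F \<longleftrightarrow> (\<forall>x\<in>X. F x \<subseteq> fibre E x) \<and> (\<exists>m. vector_bundle X m (restrict_bundle E F))"

definition strictly_in ::
  "('n::finite) ppoint set \<Rightarrow> ('n ppoint \<Rightarrow> 'e set) \<Rightarrow> ('n ppoint \<Rightarrow> 'e set) \<Rightarrow> bool" where
  "strictly_in X F G \<longleftrightarrow> (\<forall>x\<in>X. F x \<subseteq> G x) \<and> (\<exists>x\<in>X. F x \<noteq> G x)"

definition bundle_rank :: "('n::finite) ppoint set \<Rightarrow> ('n, 'e::ab_group_add) vbundle \<Rightarrow> nat" where
  "bundle_rank X E = (THE m. vector_bundle X m E)"

definition ndet :: "nat \<Rightarrow> (nat \<Rightarrow> nat \<Rightarrow> complex) \<Rightarrow> complex" where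
  "ndet m A = (\<Sum>\<pi> | \<pi> permutes {..<m}. of_int (sign \<pi>) * (\<Prod>p<m. A p (\<pi> p)))"

text \<open>The degree is the degree of the determinant line bundle: a frame \<open>s\<close> over a nonempty open set
  \<open>D\<close> gives the rational section \<open>s 0 \<and> \<dots> \<and> s (m - 1)\<close> of the determinant, whose order at \<open>p\<close> is
  that of the determinant of \<open>s\<close> with respect to a frame \<open>e\<close> around \<open>p\<close>.\<close>

definition det_order ::
  "('n::finite) ppoint set \<Rightarrow> nat \<Rightarrow> ('n, 'e::ab_group_add) vbundle \<Rightarrow> 'n ppoint set \<Rightarrow>
   (nat \<Rightarrow> 'n ppoint \<Rightarrow> 'e) \<Rightarrow> 'n ppoint \<Rightarrow> int \<Rightarrow> bool" where
  "det_order X m E D s p n \<longleftrightarrow> (\<exists>U e A. p \<in> U \<and> local_frame X m E U e \<and>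
     (\<forall>x\<in>U \<inter> D. \<forall>j<m. s j x = (\<Sum>i<m. smul E (A x i j) (e i x))) \<and>
     has_order X p (U \<inter> D) (\<lambda>x. ndet m (A x)) n)"

definition bundle_degree :: "('n::finite) ppoint set \<Rightarrow> ('n, 'e::ab_group_add) vbundle \<Rightarrow> int" where
  "bundle_degree X E = (THE d. \<exists>D s ord. D \<noteq> {} \<and> local_frame X (bundle_rank X E) E D s \<and>
     (\<forall>p\<in>X. det_order X (bundle_rank X E) E D s p (ord p)) \<and>
     finite {p \<in> X. ord p \<noteq> 0} \<and> d = (\<Sum>p | p \<in> X \<and> ord p \<noteq> 0. ord p))"

abbreviation sub_rank ::
  "('n::finite) ppoint set \<Rightarrow> ('n, 'e::ab_group_add) vbundle \<Rightarrow> ('n ppoint \<Rightarrow> 'e set) \<Rightarrow> nat" where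
  "sub_rank X E F \<equiv> bundle_rank X (restrict_bundle E F)"

abbreviation sub_degree ::
  "('n::finite) ppoint set \<Rightarrow> ('n, 'e::ab_group_add) vbundle \<Rightarrow> ('n ppoint \<Rightarrow> 'e set) \<Rightarrow> int" where
  "sub_degree X E F \<equiv> bundle_degree X (restrict_bundle E F)"


section \<open>Exterior powers and complete homomorphisms\<close>

text \<open>The \<open>i\<close>-th exterior power of \<open>complex ^ 'r\<close> is realized as the space of alternating
  \<open>i\<close>-tensors, given by their coordinates: functions on index lists of length \<open>i\<close> that change sign
  under transpositions.\<close>

type_synonym 'r multivec = "'r list \<Rightarrow> complex"

definition ext_power :: "nat \<Rightarrow> 'r multivec set" where
  "ext_power i = {\<omega>. (\<forall>I. length I \<noteq> i \<longrightarrow> \<omega> I = 0) \<and>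
     (\<forall>I p q. length I = i \<longrightarrow> p < q \<longrightarrow> q < i \<longrightarrow> \<omega> (I[p := I ! q, q := I ! p]) = - \<omega> I)}"

definition wedge :: "(complex ^ 'r) list \<Rightarrow> 'r multivec" where
  "wedge ys = (\<lambda>I. if length I = length ys
                   then ndet (length ys) (\<lambda>p q. (ys ! p) $ (I ! q)) else 0)"

text \<open>The canonical identification of the first exterior power with \<open>complex ^ 'r\<close>.\<close>

definition vec_of_multivec :: "'r multivec \<Rightarrow> complex ^ 'r" where
  "vec_of_multivec \<omega> = (\<chi> a. \<omega> [a])"

text \<open>A linear map from the \<open>i\<close>-th exterior power of \<open>V\<close> is, by the universal property, an
  alternating \<open>i\<close>-linear map \<open>g\<close>, where \<open>g [x1, \<dots>, xi]\<close> is the image of \<open>x1 \<and> \<dots> \<and> xi\<close>.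
  Such a \<open>g\<close> is set to \<open>0\<close> outside its domain, so that it is determined by the linear map.\<close>

definition ext_hom ::
  "(complex \<Rightarrow> 'e \<Rightarrow> 'e) \<Rightarrow> 'e::ab_group_add set \<Rightarrow> nat \<Rightarrow> ('e list \<Rightarrow> 'r multivec) set" where
  "ext_hom sc V i = {g.
     (\<forall>xs. \<not> (length xs = i \<and> set xs \<subseteq> V) \<longrightarrow> g xs = (\<lambda>I. 0)) \<and>
     (\<forall>xs. g xs \<in> ext_power i) \<and>
     (\<forall>xs p x y a b. length xs = i \<longrightarrow> set xs \<subseteq> V \<longrightarrow> p < i \<longrightarrow> x \<in> V \<longrightarrow> y \<in> V \<longrightarrow>
        g (xs[p := sc a x + sc b y]) = (\<lambda>I. a * g (xs[p := x]) I + b * g (xs[p := y]) I)) \<and>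
     (\<forall>xs p q. length xs = i \<longrightarrow> set xs \<subseteq> V \<longrightarrow> p < q \<longrightarrow> q < i \<longrightarrow> xs ! p = xs ! q \<longrightarrow>
        g xs = (\<lambda>I. 0))}"

text \<open>Tuples \<open>(f\<^sub>1, \<dots>, f\<^sub>r)\<close> and \<open>(l\<^sub>1, \<dots>, l\<^sub>r\<^sub>-\<^sub>1)\<close> are functions on \<open>nat\<close> that vanish
  outside their index range; \<open>r\<close> is \<open>CARD('r)\<close>.\<close>

type_synonym ('e, 'r) hom_tuple = "nat \<Rightarrow> 'e list \<Rightarrow> 'r multivec"

definition hom_space ::
  "(complex \<Rightarrow> 'e \<Rightarrow> 'e) \<Rightarrow> 'e::ab_group_add set \<Rightarrow> ('e, 'r::finite) hom_tuple set" where
  "hom_space sc V = {f.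
     (\<forall>i\<in>{1..CARD('r)}. f i \<in> ext_hom sc V i \<and> f i \<noteq> (\<lambda>xs I. 0)) \<and>
     (\<forall>i. i \<notin> {1..CARD('r)} \<longrightarrow> f i = (\<lambda>xs I. 0))}"

definition scalar_space :: "'r::finite itself \<Rightarrow> (nat \<Rightarrow> complex) set" where
  "scalar_space _ = {l. \<forall>i. i \<notin> {1..<CARD('r)} \<longrightarrow> l i = 0}"

definition open_homs ::
  "(complex \<Rightarrow> 'e \<Rightarrow> 'e) \<Rightarrow> 'e::ab_group_add set \<Rightarrow>
   (('e, 'r::finite) hom_tuple \<times> (nat \<Rightarrow> complex)) set" where
  "open_homs sc V = {(f, l). f \<in> hom_space sc V \<and> l \<in> scalar_space TYPE('r) \<and>
     (\<forall>i\<in>{1..<CARD('r)}. l i \<noteq> 0) \<and>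
     (\<forall>i\<in>{1..CARD('r)}. \<forall>xs. length xs = i \<longrightarrow> set xs \<subseteq> V \<longrightarrow>
        wedge (map (\<lambda>x. vec_of_multivec (f 1 [x])) xs) =
        (\<lambda>I. (\<Prod>j\<in>{1..<i}. l j ^ (i - j)) * f i xs I))}"

text \<open>The closure is taken for pointwise convergence, which on these finite-dimensional spaces of
  multilinear maps is the usual topology; \<open>open_homs\<close> is constructible, so its Zariski closure is
  the same.\<close>

definition complete_homs ::
  "(complex \<Rightarrow> 'e \<Rightarrow> 'e) \<Rightarrow> 'e::ab_group_add set \<Rightarrow>
   (('e, 'r::finite) hom_tuple \<times> (nat \<Rightarrow> complex)) set" where
  "complete_homs sc V =
     (hom_space sc V \<times> scalar_space TYPE('r)) \<inter> closure (open_homs sc V)"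


section \<open>The flags attached to a complete homomorphism\<close>

definition j_minus :: "nat \<Rightarrow> (nat \<Rightarrow> nat) \<Rightarrow> nat \<Rightarrow> nat" where
  "j_minus k rr i = Max {j \<in> {0..k}. rr j < i}"

definition j_plus :: "nat \<Rightarrow> (nat \<Rightarrow> nat) \<Rightarrow> nat \<Rightarrow> nat" where
  "j_plus k rr i = Min {j \<in> {0..k+1}. i \<le> rr j}"

definition quot :: "'a::ab_group_add set \<Rightarrow> 'a set \<Rightarrow> 'a set set" where
  "quot A B = (\<lambda>x. (+) x ` B) ` A"

definition quot_iso ::
  "(complex \<Rightarrow> 'e \<Rightarrow> 'e) \<Rightarrow> 'e::ab_group_add set \<Rightarrow> 'e set \<Rightarrow>
   (complex ^ 'r) set \<Rightarrow> (complex ^ 'r) set \<Rightarrow> ('e set \<Rightarrow> (complex ^ 'r) set) \<Rightarrow> bool" where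
  "quot_iso sc A B A' B' v \<longleftrightarrow> bij_betw v (quot A B) (quot A' B') \<and>
     (\<forall>x\<in>A. \<forall>y\<in>A. \<forall>x'\<in>A'. \<forall>y'\<in>A'. \<forall>a b.
        v ((+) x ` B) = (+) x' ` B' \<longrightarrow> v ((+) y ` B) = (+) y' ` B' \<longrightarrow>
        v ((+) (sc a x + sc b y) ` B) = (+) (a *s x' + b *s y') ` B')"

text \<open>\<open>induced_map\<close> says that \<open>h\<close> is the composition \<open>h\<^sub>i\<close> of the natural surjection, the
  isomorphism induced by the \<open>v\<^sub>j\<close>, and the natural injection. With \<open>p\<close> running over \<open>1, \<dots>, i\<close>
  and \<open>j_plus p = j_minus p + 1\<close> the number of the block containing \<open>p\<close>, the exterior power of
  \<open>V\<close> is spanned by the \<open>x\<^sub>1 \<and> \<dots> \<and> x\<^sub>i\<close> with \<open>x\<^sub>p\<close> in \<open>W (j_minus p)\<close>. The surjection sends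
  such an element to the tensor product over the blocks of the wedge products of the classes of the
  \<open>x\<^sub>p\<close> modulo \<open>W (j_plus p)\<close>, and the injection sends the corresponding product of classes of
  \<open>y\<^sub>p\<close> in \<open>W' (j_plus p)\<close> modulo \<open>W' (j_minus p)\<close> to \<open>y\<^sub>1 \<and> \<dots> \<and> y\<^sub>i\<close>. Lists are
  indexed from 0, whence \<open>Suc p\<close>.\<close>

definition induced_map ::
  "(complex \<Rightarrow> 'e \<Rightarrow> 'e) \<Rightarrow> nat \<Rightarrow> (nat \<Rightarrow> nat) \<Rightarrow> (nat \<Rightarrow> 'e::ab_group_add set) \<Rightarrow>
   (nat \<Rightarrow> (complex ^ 'r) set) \<Rightarrow> (nat \<Rightarrow> 'e set \<Rightarrow> (complex ^ 'r) set) \<Rightarrow> nat \<Rightarrow>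
   ('e list \<Rightarrow> 'r multivec) \<Rightarrow> bool" where
  "induced_map sc k rr W W' v i h \<longleftrightarrow> h \<in> ext_hom sc (W 0) i \<and>
     (\<forall>xs ys. length xs = i \<longrightarrow> length ys = i \<longrightarrow>
        (\<forall>p<i. xs ! p \<in> W (j_minus k rr (Suc p)) \<and> ys ! p \<in> W' (j_plus k rr (Suc p)) \<and>
           v (j_plus k rr (Suc p)) ((+) (xs ! p) ` W (j_plus k rr (Suc p)))
             = (+) (ys ! p) ` W' (j_minus k rr (Suc p))) \<longrightarrow>
        h xs = wedge ys)"

text \<open>The data attached to a point \<open>(f, l)\<close> of the stratum \<open>rr 1 < \<dots> < rr k < rr (k + 1) = r\<close>.

  In the last clause the product is on the side of \<open>f\<^sub>i\<close>, as in the equation that defines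
  \<open>open_homs\<close>: on the open stratum (\<open>k = 0\<close>) one has \<open>v\<^sub>1 = f\<^sub>1\<close>, hence \<open>h\<^sub>i\<close> is the
  \<open>i\<close>-th exterior power of \<open>f\<^sub>1\<close>, which is the product times \<open>f\<^sub>i\<close>.\<close>

definition hom_data ::
  "(complex \<Rightarrow> 'e \<Rightarrow> 'e) \<Rightarrow> 'e::ab_group_add set \<Rightarrow>
   ('e, 'r::finite) hom_tuple \<Rightarrow> (nat \<Rightarrow> complex) \<Rightarrow>
   nat \<Rightarrow> (nat \<Rightarrow> nat) \<Rightarrow> (nat \<Rightarrow> 'e set) \<Rightarrow> (nat \<Rightarrow> (complex ^ 'r) set) \<Rightarrow>
   (nat \<Rightarrow> 'e set \<Rightarrow> (complex ^ 'r) set) \<Rightarrow> ('e, 'r) hom_tuple \<Rightarrow> bool" where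
  "hom_data sc V f l k rr W W' v h \<longleftrightarrow>
     rr 0 = 0 \<and> rr (k+1) = CARD('r) \<and> (\<forall>j\<le>k. rr j < rr (j+1)) \<and>
     (\<forall>i\<in>{1..<CARD('r)}. l i = 0 \<longleftrightarrow> i \<in> rr ` {1..k}) \<and>
     W 0 = V \<and> W (k+1) = {0} \<and> (\<forall>j\<le>k. W (j+1) \<subset> W j) \<and>
     (\<forall>j\<le>k+1. module.subspace sc (W j) \<and> vector_space.dim sc (W j) = CARD('r) - rr j) \<and>
     W' 0 = {0} \<and> W' (k+1) = UNIV \<and> (\<forall>j\<le>k. W' j \<subset> W' (j+1)) \<and>
     (\<forall>j\<le>k+1. vec.subspace (W' j) \<and> vec.dim (W' j) = rr j) \<and>
     (\<forall>j\<in>{1..k+1}. quot_iso sc (W (j-1)) (W j) (W' j) (W' (j-1)) (v j)) \<and>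
     (\<forall>i\<in>{1..CARD('r)}. induced_map sc k rr W W' v i (h i) \<and>
        (\<forall>xs I. h i xs I = (\<Prod>j\<in>{1..<i} - rr ` {1..k}. l j ^ (i - j)) * f i xs I))"


section \<open>Stability\<close>

text \<open>A weighted flag: subbundles \<open>Es 1, \<dots>, Es m\<close> with weights, together with \<open>Es (m + 1) = E\<close>.\<close>

definition weighted_flag ::
  "('n::finite) ppoint set \<Rightarrow> ('n, 'e::ab_group_add) vbundle \<Rightarrow> nat \<Rightarrow>
   (nat \<Rightarrow> 'n ppoint \<Rightarrow> 'e set) \<Rightarrow> (nat \<Rightarrow> rat) \<Rightarrow> bool" where
  "weighted_flag X E m Es \<alpha> \<longleftrightarrow> m \<ge> 1 \<and>
     (\<forall>j\<in>{1..m}. subbundle X E (Es j) \<and> \<alpha> j > 0) \<and> (\<forall>x\<in>X. Es (m+1) x = fibre E x) \<and>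
     strictly_in X (\<lambda>x. {0}) (Es 1) \<and> (\<forall>j\<in>{1..m}. strictly_in X (Es j) (Es (j+1)))"

definition gamma ::
  "('n::finite) ppoint set \<Rightarrow> ('n, 'e::ab_group_add) vbundle \<Rightarrow> nat \<Rightarrow>
   (nat \<Rightarrow> 'n ppoint \<Rightarrow> 'e set) \<Rightarrow> (nat \<Rightarrow> rat) \<Rightarrow> nat \<Rightarrow> rat" where
  "gamma X E m Es \<alpha> l =
     (\<Sum>j=1..m. \<alpha> j * of_nat (sub_rank X E (Es j))) - of_nat (bundle_rank X E) * (\<Sum>j=l..m. \<alpha> j)"

text \<open>\<open>mu\<close> depends only on the class of \<open>g\<close> up to nonzero scalars, so that \<open>[f\<^sub>i] = [h\<^sub>i]\<close> may be
  represented by \<open>f\<^sub>i\<close> in \<open>mu2\<close>.\<close>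

definition mu ::
  "('n::finite) ppoint set \<Rightarrow> 'n ppoint \<Rightarrow> ('n, 'e::ab_group_add) vbundle \<Rightarrow> nat \<Rightarrow>
   (nat \<Rightarrow> 'n ppoint \<Rightarrow> 'e set) \<Rightarrow> (nat \<Rightarrow> rat) \<Rightarrow> nat \<Rightarrow> ('e list \<Rightarrow> 'r multivec) \<Rightarrow> rat" where
  "mu X x0 E m Es \<alpha> i g = - Min {(\<Sum>p<i. gamma X E m Es \<alpha> (ls ! p)) | ls.
     length ls = i \<and> set ls \<subseteq> {1..m+1} \<and>
     (\<exists>xs. length xs = i \<and> (\<forall>p<i. xs ! p \<in> Es (ls ! p) x0) \<and> g xs \<noteq> (\<lambda>I. 0))}"

definition mu2 ::
  "('n::finite) ppoint set \<Rightarrow> 'n ppoint \<Rightarrow> (nat \<Rightarrow> nat) \<Rightarrow> ('n, 'e::ab_group_add) vbundle \<Rightarrow> nat \<Rightarrow>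
   (nat \<Rightarrow> 'n ppoint \<Rightarrow> 'e set) \<Rightarrow> (nat \<Rightarrow> rat) \<Rightarrow> ('e, 'r::finite) hom_tuple \<Rightarrow> rat" where
  "mu2 X x0 \<theta> E m Es \<alpha> f = (\<Sum>i=1..CARD('r). of_nat (\<theta> i) * mu X x0 E m Es \<alpha> i (f i))"

definition M_weight ::
  "('n::finite) ppoint set \<Rightarrow> ('n, 'e::ab_group_add) vbundle \<Rightarrow> nat \<Rightarrow>
   (nat \<Rightarrow> 'n ppoint \<Rightarrow> 'e set) \<Rightarrow> (nat \<Rightarrow> rat) \<Rightarrow> rat" where
  "M_weight X E m Es \<alpha> = (\<Sum>j=1..m. \<alpha> j *
     (of_int (bundle_degree X E) * of_nat (sub_rank X E (Es j))
      - of_int (sub_degree X E (Es j)) * of_nat (bundle_rank X E)))"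

definition level_semistable ::
  "('n::finite) ppoint set \<Rightarrow> 'n ppoint \<Rightarrow> (nat \<Rightarrow> nat) \<Rightarrow> rat \<Rightarrow>
   ('n, 'e::ab_group_add) vbundle \<Rightarrow> ('e, 'r::finite) hom_tuple \<Rightarrow> bool" where
  "level_semistable X x0 \<theta> \<delta> E f \<longleftrightarrow> (\<forall>m Es \<alpha>. weighted_flag X E m Es \<alpha> \<longrightarrow>
     M_weight X E m Es \<alpha> + \<delta> * mu2 X x0 \<theta> E m Es \<alpha> f \<ge> 0)"

definition level_stable ::
  "('n::finite) ppoint set \<Rightarrow> 'n ppoint \<Rightarrow> (nat \<Rightarrow> nat) \<Rightarrow> rat \<Rightarrow>
   ('n, 'e::ab_group_add) vbundle \<Rightarrow> ('e, 'r::finite) hom_tuple \<Rightarrow> bool" where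
  "level_stable X x0 \<theta> \<delta> E f \<longleftrightarrow> (\<forall>m Es \<alpha>. weighted_flag X E m Es \<alpha> \<longrightarrow>
     M_weight X E m Es \<alpha> + \<delta> * mu2 X x0 \<theta> E m Es \<alpha> f > 0)"

definition q_fun :: "nat \<Rightarrow> (nat \<Rightarrow> nat) \<Rightarrow> nat \<Rightarrow> rat" where
  "q_fun r \<theta> t = (\<Sum>i=1..t. of_nat (\<theta> i) * of_nat i) + (\<Sum>i=t+1..r. of_nat (\<theta> i) * of_nat t)
     - of_nat t / of_nat r * (\<Sum>i=1..r. of_nat (\<theta> i) * of_nat i)"

text \<open>The sum over \<open>s\<close> in the criterion, for \<open>V = F x0\<close>; as \<open>V \<inter> W (j_plus s)\<close> is contained in
  \<open>V \<inter> W (j_minus s)\<close>, the dimension of the quotient is the difference of the dimensions.\<close>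

definition flag_term ::
  "(complex \<Rightarrow> 'e \<Rightarrow> 'e) \<Rightarrow> nat \<Rightarrow> (nat \<Rightarrow> nat) \<Rightarrow> nat \<Rightarrow> (nat \<Rightarrow> nat) \<Rightarrow>
   (nat \<Rightarrow> 'e::ab_group_add set) \<Rightarrow> 'e set \<Rightarrow> rat" where
  "flag_term sc r \<theta> k rr W V = (\<Sum>s \<in> rr ` {1..k+1}.
     q_fun r \<theta> (rr (j_minus k rr s) +
        (vector_space.dim sc (V \<inter> W (j_minus k rr s)) - vector_space.dim sc (V \<inter> W (j_plus k rr s))))
     - q_fun r \<theta> (rr (j_minus k rr s)))"

end

theory Submission
  imports Defs
begin

text \<open>The quantity \<open>M + \<delta>\<^sub>2 \<mu>\<^sub>2\<close> turns out to be a sum over the members of the weighted flag, with positive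
  coefficients \<open>\<alpha>\<^sub>j\<close>, so its sign needs to be tested on flags \<open>0 \<subset> F \<subset> E\<close> only. For \<open>M\<close> additivity is its definition; for \<open>\<mu>\<^sub>2\<close> it is the content of the proof,
  because a minimum of sums \<open>\<gamma>\<^sub>l\<^sub>1 + \<dots> + \<gamma>\<^sub>l\<^sub>i\<close> is in general not additive in the weights.

  The reason is that the index lists \<open>ls\<close> with \<open>h\<^sub>i (V\<^sub>l\<^sub>1 \<and> \<dots> \<and> V\<^sub>l\<^sub>i) \<noteq> 0\<close> behave like bases of a matroid
  (lemmas \<open>count_le_wedge_rank\<close>, \<open>ex_count_eq_wedge_rank\<close>): the number of \<open>p\<close> with \<open>ls ! p \<le> a\<close> is
  at most a number \<open>wedge_rank i (V\<^sub>a)\<close> depending on \<open>V\<^sub>a\<close> alone, and one greedy list attains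
  all these bounds simultaneously. Up to a constant, \<open>\<gamma>\<^sub>l\<^sub>1 + \<dots> + \<gamma>\<^sub>l\<^sub>i\<close> is a combination of the numbers of
  \<open>p\<close> with \<open>ls ! p \<le> a\<close> in which each has the negative coefficient \<open>- \<alpha>\<^sub>a r\<close> (lemma \<open>sum_gamma\<close>).
  Hence the greedy list is the minimizer for all weights, and \<open>\<mu>\<close> is linear in \<open>\<alpha>\<close> (lemma \<open>mu_eq\<close>).

  To see this, choose a basis \<open>B\<close> of the fibre adapted to both the flag \<open>V\<^sub>\<bullet>\<close> and the flag
  \<open>W\<^sub>\<bullet>\<close> (lemma \<open>adapted_basis\<close>). The basis vectors in \<open>W\<^sub>b\<close> outside \<open>W\<^sub>b\<^sub>+\<^sub>1\<close> form the block \<open>b\<close>, which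
  has \<open>r\<^sub>b\<^sub>+\<^sub>1 - r\<^sub>b\<close> elements. On distinct elements of \<open>B\<close> the map \<open>h\<^sub>i\<close> is nonzero exactly if they fill
  up the blocks in order, that is, if they contain \<open>min i r\<^sub>b\<^sub>+\<^sub>1 - min i r\<^sub>b\<close> elements of each block
  (lemma \<open>h_sorted_nonzero_iff\<close>). Multilinearity reduces all vectors to elements of \<open>B\<close>, and
  the rest is counting: with \<open>d\<^sub>b = dim (U \<inter> W\<^sub>b) / (U \<inter> W\<^sub>b\<^sub>+\<^sub>1)\<close> one finds
  \<open>wedge_rank i U = \<Sum>\<^sub>b (min i (r\<^sub>b + d\<^sub>b) - min i r\<^sub>b)\<close>. Finally \<open>q t\<close> is \<open>\<Sum>\<^sub>i \<theta>\<^sub>i min i t\<close> minus a term linear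
  in \<open>t\<close>, so that summing \<open>\<theta>\<^sub>i\<close> times these formulas over \<open>i\<close> gives the sum of differences of \<open>q\<close>
  in the criterion (lemma \<open>flag_term_eq\<close>).\<close>

section \<open>Wedge products of independent vectors\<close>

text \<open>The coefficient of the entry \<open>A p n\<close> in the expansion along the last column; keeping it as a sum over
  permutations avoids renumbering rows.\<close>
definition last_cofactor :: "nat \<Rightarrow> (nat \<Rightarrow> nat \<Rightarrow> complex) \<Rightarrow> nat \<Rightarrow> complex" where
  "last_cofactor n A p = (\<Sum>\<pi> | \<pi> permutes {..<Suc n} \<and> \<pi> p = n.
     of_int (sign \<pi>) * (\<Prod>q\<in>{..<Suc n} - {p}. A q (\<pi> q)))"

lemma ndet_expand_last_column:
  "ndet (Suc n) A = (\<Sum>p<Suc n. A p n * last_cofactor n A p)"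
proof -
  let ?P = "{\<pi>. \<pi> permutes {..<Suc n}}"
  have fin: "finite ?P" by (simp add: finite_permutations)
  have disj: "?P = (\<Union>p\<in>{..<Suc n}. {\<pi>. \<pi> permutes {..<Suc n} \<and> \<pi> p = n})"
  proof -
    have "\<exists>p<Suc n. \<pi> p = n" if "\<pi> permutes {..<Suc n}" for \<pi>
    proof -
      have "n \<in> \<pi> ` {..<Suc n}" using permutes_image[OF that] by simp
      then show ?thesis by auto
    qed
    then show ?thesis by auto
  qed
  have "ndet (Suc n) A = (\<Sum>\<pi>\<in>(\<Union>p\<in>{..<Suc n}. {\<pi>. \<pi> permutes {..<Suc n} \<and> \<pi> p = n}).
      of_int (sign \<pi>) * (\<Prod>q<Suc n. A q (\<pi> q)))"
    unfolding ndet_def by (subst disj) simp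
  also have "\<dots> = (\<Sum>p<Suc n. \<Sum>\<pi> | \<pi> permutes {..<Suc n} \<and> \<pi> p = n.
      of_int (sign \<pi>) * (\<Prod>q<Suc n. A q (\<pi> q)))"
  proof (rule sum.UNION_disjoint)
    show "\<forall>i\<in>{..<Suc n}. finite {\<pi>. \<pi> permutes {..<Suc n} \<and> \<pi> i = n}"
      using fin by (auto intro: finite_subset[OF _ fin])
    show "\<forall>i\<in>{..<Suc n}. \<forall>j\<in>{..<Suc n}. i \<noteq> j \<longrightarrow>
      {\<pi>. \<pi> permutes {..<Suc n} \<and> \<pi> i = n} \<inter> {\<pi>. \<pi> permutes {..<Suc n} \<and> \<pi> j = n} = {}"
      by (auto dest!: permutes_inj simp: inj_def)
  qed simp
  also have "\<dots> = (\<Sum>p<Suc n. A p n * last_cofactor n A p)"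
  proof (rule sum.cong[OF refl])
    fix p assume p: "p \<in> {..<Suc n}"
    show "(\<Sum>\<pi> | \<pi> permutes {..<Suc n} \<and> \<pi> p = n. of_int (sign \<pi>) * (\<Prod>q<Suc n. A q (\<pi> q)))
      = A p n * last_cofactor n A p"
      unfolding last_cofactor_def sum_distrib_left
      using p by (intro sum.cong refl) (subst prod.remove[of _ p], auto simp: mult_ac)
  qed
  finally show ?thesis .
qed

lemma last_cofactor_cong:
  assumes "\<And>q c. c < n \<Longrightarrow> A q c = A' q c"
  shows "last_cofactor n A p = last_cofactor n A' p"
  unfolding last_cofactor_def
proof (intro sum.cong refl arg_cong2[of _ _ _ _ "(*)"] prod.cong)
  fix \<pi> q assume \<pi>: "\<pi> \<in> {\<pi>. \<pi> permutes {..<Suc n} \<and> \<pi> p = n}" and q: "q \<in> {..<Suc n} - {p}"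
  have "\<pi> q \<noteq> \<pi> p" using \<pi> q permutes_inj[of \<pi> "{..<Suc n}"] by (auto simp: inj_def)
  moreover have "\<pi> q < Suc n" using \<pi> q permutes_in_image[of \<pi> "{..<Suc n}" q] by auto
  ultimately show "A q (\<pi> q) = A' q (\<pi> q)" using \<pi> assms by auto
qed

lemma last_cofactor_corner: "last_cofactor n A n = ndet n A"
proof -
  have *: "{\<pi>. \<pi> permutes {..<Suc n} \<and> \<pi> n = n} = {\<pi>. \<pi> permutes {..<n}}"
    by (auto simp: lessThan_Suc intro: permutes_superset permutes_subset)
       (auto simp: permutes_def)
  have "{..<Suc n} - {n} = {..<n}" by auto
  then show ?thesis unfolding last_cofactor_def ndet_def * by simp
qed

lemma wedge_zero_entry:
  assumes "p < length ys" "ys ! p = 0"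
  shows "wedge ys = (\<lambda>I. 0)"
  using assms unfolding wedge_def ndet_def
  by (auto intro!: ext sum.neutral prod_zero bexI[of _ p])

text \<open>By induction: if the first \<open>n\<close> vectors have a nonzero minor in the columns \<open>I\<close>, then the minors
  in the columns \<open>I @ [a]\<close> are, as \<open>a\<close> varies, the components of a linear combination of all
  \<open>n + 1\<close> vectors. Its last coefficient is the nonzero minor, hence it is not zero.\<close>
lemma wedge_independent:
  fixes ys :: "(complex ^ 'r) list"
  assumes "\<And>c. (\<Sum>p<length ys. c p *s ys ! p) = 0 \<Longrightarrow> \<forall>p<length ys. c p = 0"
  shows "\<exists>I. length I = length ys \<and> wedge ys I \<noteq> 0"
  using assms
proof (induction ys rule: rev_induct)
  case Nil
  then show ?case by (auto simp: wedge_def ndet_def)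
next
  case (snoc y ys)
  let ?n = "length ys" and ?ys = "ys @ [y]"
  have "\<exists>I. length I = ?n \<and> wedge ys I \<noteq> 0"
  proof (rule snoc.IH)
    fix c assume c: "(\<Sum>p<?n. c p *s ys ! p) = 0"
    have "(\<Sum>p<length ?ys. (c(?n := 0)) p *s ?ys ! p) = (\<Sum>p<?n. c p *s ys ! p)"
      by (simp add: nth_append cong: sum.cong_simp)
    then have "\<forall>p<length ?ys. (c(?n := 0)) p = 0" using c by (intro snoc.prems) simp
    then show "\<forall>p<?n. c p = 0" by (metis fun_upd_other length_append_singleton less_SucI nat_neq_iff)
  qed
  then obtain I where I: "length I = ?n" "wedge ys I \<noteq> 0" by blast
  define A where "A a = (\<lambda>p q. ?ys ! p $ ((I @ [a]) ! q))" for a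
  define C where "C = last_cofactor ?n (\<lambda>p q. ?ys ! p $ (I ! q))"
  have C: "last_cofactor ?n (A a) p = C p" for a p
    unfolding C_def A_def using I by (intro last_cofactor_cong) (simp add: nth_append)
  have val: "wedge ?ys (I @ [a]) = (\<Sum>p<Suc ?n. C p *s ?ys ! p) $ a" for a
  proof -
    have "wedge ?ys (I @ [a]) = ndet (Suc ?n) (A a)" using I by (simp add: wedge_def A_def)
    also have "\<dots> = (\<Sum>p<Suc ?n. A a p ?n * C p)" by (simp add: ndet_expand_last_column C)
    also have "\<dots> = (\<Sum>p<Suc ?n. C p *s ?ys ! p) $ a"
      using I by (simp add: sum_component A_def nth_append mult.commute)
    finally show ?thesis .
  qed
  have "C ?n = wedge ys I"
  proof -
    have "C ?n = ndet ?n (\<lambda>p q. ?ys ! p $ (I ! q))" unfolding C_def by (rule last_cofactor_corner)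
    also have "\<dots> = ndet ?n (\<lambda>p q. ys ! p $ (I ! q))"
      unfolding ndet_def by (intro sum.cong refl arg_cong2[of _ _ _ _ "(*)"] prod.cong) (simp add: nth_append)
    finally show ?thesis using I by (simp add: wedge_def)
  qed
  then have Cn: "C ?n \<noteq> 0" using I by simp
  have "(\<Sum>p<Suc ?n. C p *s ?ys ! p) \<noteq> 0"
  proof
    assume "(\<Sum>p<Suc ?n. C p *s ?ys ! p) = 0"
    then have "\<forall>p<length ?ys. C p = 0" by (intro snoc.prems) (simp only: length_append_singleton)
    then show False using Cn by simp
  qed
  then obtain a where "(\<Sum>p<Suc ?n. C p *s ?ys ! p) $ a \<noteq> 0"
    unfolding vec_eq_iff zero_index by blast
  then have "wedge ?ys (I @ [a]) \<noteq> 0" unfolding val .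
  then show ?case using I by (intro exI[of _ "I @ [a]"]) simp
qed

section \<open>Alternating multilinear maps\<close>

lemma ext_hom_length:
  assumes "g \<in> ext_hom sc V i" "g xs \<noteq> (\<lambda>I. 0)"
  shows "length xs = i" "set xs \<subseteq> V"
  using assms unfolding ext_hom_def by blast+

lemma ext_hom_linear:
  assumes "g \<in> ext_hom sc V i" "length xs = i" "set xs \<subseteq> V" "p < i" "x \<in> V" "y \<in> V"
  shows "g (xs[p := sc a x + sc b y]) = (\<lambda>I. a * g (xs[p := x]) I + b * g (xs[p := y]) I)"
  using assms unfolding ext_hom_def by blast

lemma ext_hom_repeated:
  assumes "g \<in> ext_hom sc V i" "length xs = i" "set xs \<subseteq> V" "p < i" "q < i" "p \<noteq> q" "xs ! p = xs ! q"
  shows "g xs = (\<lambda>I. 0)"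
proof -
  have "g xs = (\<lambda>I. 0)" if "p < q" "q < i" "xs ! p = xs ! q" for p q
    using assms(1-3) that unfolding ext_hom_def by blast
  then show ?thesis using assms(4-) by (metis linorder_neqE_nat)
qed

lemma ext_hom_distinct:
  assumes "g \<in> ext_hom sc V i" "g xs \<noteq> (\<lambda>I. 0)"
  shows "distinct xs"
  using ext_hom_repeated[OF assms(1) ext_hom_length[OF assms]] ext_hom_length(1)[OF assms] assms(2)
  unfolding distinct_conv_nth by blast

context
  fixes sc :: "complex \<Rightarrow> 'e \<Rightarrow> 'e::ab_group_add"
  assumes vs: "vector_space sc"
begin

interpretation vector_space sc by (rule vs)

text \<open>The polarization argument: expand the vanishing value at two equal entries \<open>x + y\<close>.\<close>
lemma ext_hom_swap:
  assumes g: "g \<in> ext_hom sc V i" and V: "module.subspace sc V"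
    and xs: "length xs = i" "set xs \<subseteq> V" and pq: "p < i" "q < i" "p \<noteq> q"
    and nz: "g (xs[p := xs ! q, q := xs ! p]) \<noteq> (\<lambda>I. 0)"
  shows "g xs \<noteq> (\<lambda>I. 0)"
proof
  assume z: "g xs = (\<lambda>I. 0)"
  define x y where "x = xs ! p" and "y = xs ! q"
  have xy: "x \<in> V" "y \<in> V" "x + y \<in> V"
    using xs pq V by (auto simp: x_def y_def subspace_add) (meson nth_mem subsetD subspace_add)
  have sub: "set (ys[a := u]) \<subseteq> V" if "set ys \<subseteq> V" "u \<in> V" for ys :: "'e list" and a u
    using that set_update_subset_insert by fastforce
  have add: "g (ys[a := u + w]) I = g (ys[a := u]) I + g (ys[a := w]) I"
    if "length ys = i" "set ys \<subseteq> V" "a < i" "u \<in> V" "w \<in> V" for ys a u w I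
    using ext_hom_linear[OF g that, of 1 1] by simp
  have rep: "g (xs[p := u, q := u]) = (\<lambda>I. 0)" if "u \<in> V" for u
    using xs pq that by (intro ext_hom_repeated[OF g, of _ p q]) (auto simp: sub)
  have "g (xs[p := x, q := y]) = (\<lambda>I. 0)" using z by (simp add: x_def y_def)
  moreover have "g (xs[p := x + y, q := x + y]) I =
      g (xs[p := x, q := x]) I + g (xs[p := x, q := y]) I
      + g (xs[p := y, q := x]) I + g (xs[p := y, q := y]) I" for I
  proof -
    have "g (xs[p := x + y, q := x + y]) I
        = g (xs[p := x + y, q := x]) I + g (xs[p := x + y, q := y]) I"
      using xs xy pq by (intro add) (auto simp: sub)
    moreover have "g (xs[p := x + y, q := u]) I = g (xs[p := x, q := u]) I + g (xs[p := y, q := u]) I"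
      if "u \<in> V" for u
      using add[of "xs[q := u]" p x y I] xs xy pq that by (simp add: sub list_update_swap)
    ultimately show ?thesis using xy by simp
  qed
  ultimately have "g (xs[p := y, q := x]) I = 0" for I
    using rep[OF xy(1)] rep[OF xy(2)] rep[OF xy(3)] by (simp add: fun_eq_iff)
  then show False using nz by (auto simp: x_def y_def)
qed

lemma ext_hom_permute:
  assumes g: "g \<in> ext_hom sc V i" and V: "module.subspace sc V"
    and nz: "g xs \<noteq> (\<lambda>I. 0)" and mset: "mset xs = mset ys"
  shows "g ys \<noteq> (\<lambda>I. 0)"
proof -
  have len: "length ys = i" "set ys \<subseteq> V"
    using ext_hom_length[OF g nz] mset mset_eq_length mset_eq_setD by metis+
  from mset obtain \<pi> where \<pi>: "\<pi> permutes {..<length ys}" "permute_list \<pi> ys = xs"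
    by (rule mset_eq_permutation)
  have "\<forall>zs. length zs = i \<longrightarrow> set zs \<subseteq> V \<longrightarrow>
      g (map (\<lambda>q. zs ! \<pi> q) [0..<i]) \<noteq> (\<lambda>I. 0) \<longrightarrow> g zs \<noteq> (\<lambda>I. 0)"
    using \<pi>(1) finite_lessThan
  proof (induction rule: permutes_induct)
    case id
    then show ?case by (auto simp: map_nth)
  next
    case (swap a b p)
    show ?case
    proof (intro allI impI)
      fix zs assume zs: "length zs = i" "set zs \<subseteq> V"
        "g (map (\<lambda>q. zs ! (Transposition.transpose a b \<circ> p) q) [0..<i]) \<noteq> (\<lambda>I. 0)"
      have ab: "a < i" "b < i" "a \<noteq> b" using swap.hyps len by auto
      define ws where "ws = zs[a := zs ! b, b := zs ! a]"
      have ws: "length ws = i" "set ws \<subseteq> V"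
        using zs ab by (auto simp: ws_def set_conv_nth nth_list_update)
      have "map (\<lambda>q. zs ! (Transposition.transpose a b \<circ> p) q) [0..<i] = map (\<lambda>q. ws ! p q) [0..<i]"
      proof (intro map_cong refl)
        fix q assume "q \<in> set [0..<i]"
        then have "p q < i" using permutes_in_image[OF swap.hyps(4), of q] len by simp
        then show "zs ! (Transposition.transpose a b \<circ> p) q = ws ! p q"
          using ab zs(1) by (auto simp: ws_def nth_list_update Transposition.transpose_def)
      qed
      then have "g (map (\<lambda>q. ws ! p q) [0..<i]) \<noteq> (\<lambda>I. 0)" using zs(3) by metis
      then have "g ws \<noteq> (\<lambda>I. 0)" using swap.IH ws by blast
      then show "g zs \<noteq> (\<lambda>I. 0)" unfolding ws_def using ext_hom_swap[OF g V zs(1,2) ab] by blast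
    qed
  qed
  moreover have "map (\<lambda>q. ys ! \<pi> q) [0..<i] = xs" using \<pi> len by (simp add: permute_list_def)
  ultimately show ?thesis using len nz by blast
qed

lemma ext_hom_span_entry:
  assumes g: "g \<in> ext_hom sc V i" and V: "module.subspace sc V"
    and xs: "length xs = i" "set xs \<subseteq> V" "p < i" and C: "C \<subseteq> V" "xs ! p \<in> module.span sc C"
    and nz: "g xs \<noteq> (\<lambda>I. 0)"
  shows "\<exists>c\<in>C. g (xs[p := c]) \<noteq> (\<lambda>I. 0)"
proof (rule ccontr)
  assume none: "\<not> ?thesis"
  let ?K = "{x \<in> V. g (xs[p := x]) = (\<lambda>I. 0)}"
  have lin: "g (xs[p := sc a x + sc b y]) = (\<lambda>I. a * g (xs[p := x]) I + b * g (xs[p := y]) I)"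
    if "x \<in> V" "y \<in> V" for a b x y using ext_hom_linear[OF g xs that] .
  have "subspace ?K"
  proof (rule subspaceI)
    have "0 \<in> V" using V by (rule subspace_0)
    then show "0 \<in> ?K" using lin[of 0 0 0 0] by simp
    show "x + y \<in> ?K" if "x \<in> ?K" "y \<in> ?K" for x y
      using that lin[of x y 1 1] V by (auto simp: subspace_add)
    show "sc c x \<in> ?K" if "x \<in> ?K" for c x
      using that lin[of x x c 0] V by (auto simp: subspace_scale)
  qed
  then have "span C \<subseteq> ?K" using C none by (intro span_minimal) auto
  then show False using C(2) nz by auto
qed

text \<open>Multilinear expansion, one entry at a time; it reduces arbitrary vectors to elements of an adapted
  basis.\<close>
lemma ext_hom_span:
  assumes g: "g \<in> ext_hom sc V i" and V: "module.subspace sc V"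
    and C: "\<And>p. p < i \<Longrightarrow> C p \<subseteq> V \<and> xs ! p \<in> module.span sc (C p)"
    and nz: "g xs \<noteq> (\<lambda>I. 0)"
  obtains bs where "length bs = i" "\<And>p. p < i \<Longrightarrow> bs ! p \<in> C p" "g bs \<noteq> (\<lambda>I. 0)"
proof -
  have "\<exists>bs. (\<forall>p<n. bs ! p \<in> C p) \<and> (\<forall>p\<in>{n..<i}. bs ! p = xs ! p) \<and> g bs \<noteq> (\<lambda>I. 0)"
    if "n \<le> i" for n
    using that
  proof (induction n)
    case 0
    then show ?case using nz by auto
  next
    case (Suc n)
    then obtain bs where bs: "\<forall>p<n. bs ! p \<in> C p" "\<forall>p\<in>{n..<i}. bs ! p = xs ! p" "g bs \<noteq> (\<lambda>I. 0)"
      by auto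
    note len = ext_hom_length[OF g bs(3)]
    obtain c where c: "c \<in> C n" "g (bs[n := c]) \<noteq> (\<lambda>I. 0)"
      using ext_hom_span_entry[OF g V len, of n "C n"] C[of n] bs Suc.prems by auto
    then show ?case using bs len Suc.prems
      by (intro exI[of _ "bs[n := c]"]) (auto simp: nth_list_update)
  qed
  from this[of i] that show ?thesis using ext_hom_length(1)[OF g] by auto
qed

end

section \<open>Bases adapted to two flags\<close>

lemma (in vector_space) independent_sum_in_span:
  assumes B: "independent B" "C \<subseteq> B" and P: "finite P" "inj_on x P" "x ` P \<subseteq> B - C"
    and sum: "(\<Sum>p\<in>P. scale (c p) (x p)) \<in> span C"
  shows "\<forall>p\<in>P. c p = 0"
proof (rule ballI, rule ccontr)
  fix p assume p: "p \<in> P" and nz: "c p \<noteq> 0"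
  let ?D = "B - {x p}"
  have "C \<subseteq> ?D" using B P p by auto
  then have 1: "(\<Sum>p\<in>P. scale (c p) (x p)) \<in> span ?D" using sum span_mono by blast
  have "x q \<in> ?D" if "q \<in> P - {p}" for q
    using that P p by (auto simp: inj_on_def)
  then have 2: "(\<Sum>q\<in>P - {p}. scale (c q) (x q)) \<in> span ?D"
    by (intro span_sum span_scale span_base)
  have "scale (c p) (x p) = (\<Sum>p\<in>P. scale (c p) (x p)) - (\<Sum>q\<in>P - {p}. scale (c q) (x q))"
    using sum.remove[OF P(1) p, of "\<lambda>p. scale (c p) (x p)"] by simp
  then have "scale (c p) (x p) \<in> span ?D" using 1 2 by (simp add: span_diff)
  then have "scale (inverse (c p)) (scale (c p) (x p)) \<in> span ?D" by (rule span_scale)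
  then have "x p \<in> span ?D" using nz by simp
  then show False using B P p unfolding dependent_def by auto
qed

context vector_space
begin

text \<open>The basis is extended along \<open>U\<^sub>0 \<subseteq> U\<^sub>1 \<subseteq> \<dots>\<close>, at step \<open>t\<close> to a basis of the span of \<open>A1\<close> and
  \<open>U\<^sub>t \<inter> A2\<close>. The vectors added so far lie in \<open>U\<^sub>t\<close>; subtracting their contribution from an element
  of \<open>U\<^sub>t \<inter> A2\<close> leaves an element of \<open>U\<^sub>t \<inter> A1\<close>, where the given basis is adapted already.\<close>
lemma extend_adapted_basis:
  fixes n :: nat
  assumes B1: "independent B1" "A1 \<subseteq> span B1" "B1 \<subseteq> A1" and A: "subspace A1" "A1 \<subseteq> A2"
    and U: "\<And>a. a \<le> n \<Longrightarrow> subspace (U a)" "\<And>a b. a \<le> b \<Longrightarrow> b \<le> n \<Longrightarrow> U a \<subseteq> U b"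
    and ad: "\<And>a. a \<le> n \<Longrightarrow> U a \<inter> A1 \<subseteq> span (B1 \<inter> U a)"
  shows "\<exists>B. B1 \<subseteq> B \<and> B \<subseteq> A2 \<and> independent B \<and> (\<forall>a\<le>n. U a \<inter> A2 \<subseteq> span (B \<inter> U a))"
proof -
  have "\<exists>B. B1 \<subseteq> B \<and> B \<subseteq> A2 \<and> B \<subseteq> B1 \<union> (\<Union>a<t. U a) \<and> independent B \<and>
      (\<forall>a<t. U a \<inter> A2 \<subseteq> span (B \<inter> U a))"
    if "t \<le> Suc n" for t using that
  proof (induction t)
    case 0
    then show ?case using B1 A by (intro exI[of _ B1]) auto
  next
    case (Suc t)
    then obtain B where B: "B1 \<subseteq> B" "B \<subseteq> A2" "B \<subseteq> B1 \<union> (\<Union>a<t. U a)" "independent B"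
      and adB: "\<And>a. a < t \<Longrightarrow> U a \<inter> A2 \<subseteq> span (B \<inter> U a)" by auto
    obtain B' where B': "B \<subseteq> B'" "B' \<subseteq> B \<union> (U t \<inter> A2)" "independent B'" "B \<union> (U t \<inter> A2) \<subseteq> span B'"
      using maximal_independent_subset_extend[of B "B \<union> (U t \<inter> A2)"] B by auto
    have "(\<Union>a<t. U a) \<subseteq> U t" using Suc.prems by (intro UN_least U(2)) auto
    then have sub: "B' - B1 \<subseteq> U t" using B'(2) B(3) by blast
    have "U t \<inter> A2 \<subseteq> span (B' \<inter> U t)"
    proof
      fix x assume x: "x \<in> U t \<inter> A2"
      have "x \<in> span (B1 \<union> (B' - B1))" using x B' B by (auto simp: Un_absorb1)
      then obtain w y where wy: "x = w + y" "w \<in> span B1" "y \<in> span (B' - B1)"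
        unfolding span_Un by auto
      have "y \<in> U t" using wy sub U(1)[of t] Suc.prems span_minimal by (metis in_mono less_Suc_eq_le Suc_le_lessD)
      moreover have "w = x - y" using wy by simp
      ultimately have "w \<in> U t" using x U(1)[of t] Suc.prems by (auto intro: subspace_diff)
      moreover have "w \<in> A1" using wy B1 A span_minimal by blast
      ultimately have "w \<in> span (B1 \<inter> U t)" using ad[of t] Suc.prems by auto
      then have "w \<in> span (B' \<inter> U t)" using span_mono[of "B1 \<inter> U t" "B' \<inter> U t"] B B' by auto
      moreover have "y \<in> span (B' \<inter> U t)"
        using wy span_mono[of "B' - B1" "B' \<inter> U t"] sub by auto
      ultimately show "x \<in> span (B' \<inter> U t)" using wy by (simp add: span_add)
    qed
    moreover have "U a \<inter> A2 \<subseteq> span (B' \<inter> U a)" if "a < t" for a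
      using adB[OF that] span_mono[of "B \<inter> U a" "B' \<inter> U a"] B' by auto
    ultimately have "\<forall>a<Suc t. U a \<inter> A2 \<subseteq> span (B' \<inter> U a)" by (simp add: less_Suc_eq)
    moreover have "B' \<subseteq> B1 \<union> (\<Union>a<Suc t. U a)" using sub by auto
    ultimately show ?case using B B' by (intro exI[of _ B']) blast
  qed
  from this[of "Suc n"] show ?thesis by (auto simp: less_Suc_eq_le)
qed

text \<open>Induction along \<open>A\<close>. That two flags have a common adapted basis is the linear algebra behind the
  Bruhat decomposition.\<close>
lemma adapted_basis:
  fixes n K :: nat
  assumes U: "\<And>a. a \<le> n \<Longrightarrow> subspace (U a)" "\<And>a b. a \<le> b \<Longrightarrow> b \<le> n \<Longrightarrow> U a \<subseteq> U b"
    and A: "\<And>j. j \<le> K \<Longrightarrow> subspace (A j)" "\<And>j. j < K \<Longrightarrow> A j \<subseteq> A (Suc j)" "A 0 = {0}"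
    and top: "A K \<subseteq> U n"
  shows "\<exists>B. B \<subseteq> A K \<and> independent B \<and> (\<forall>a\<le>n. \<forall>j\<le>K. U a \<inter> A j \<subseteq> span (B \<inter> U a \<inter> A j))"
  using A(1,2) top
proof (induction K)
  case 0
  then show ?case using A(3) by (intro exI[of _ "{}"]) (auto simp: independent_empty)
next
  case (Suc K)
  have AK: "A K \<subseteq> A (Suc K)" "subspace (A K)" "subspace (A (Suc K))" using Suc.prems by auto
  then obtain B1 where B1: "B1 \<subseteq> A K" "independent B1"
    and ad1: "\<And>a j. a \<le> n \<Longrightarrow> j \<le> K \<Longrightarrow> U a \<inter> A j \<subseteq> span (B1 \<inter> U a \<inter> A j)"
    using Suc.IH Suc.prems by (metis le_Suc_eq less_Suc_eq subset_trans)
  have sp1: "A K \<subseteq> span B1"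
  proof -
    have "A K \<subseteq> U n \<inter> A K" using AK(1) Suc.prems(3) by blast
    also have "\<dots> \<subseteq> span (B1 \<inter> U n \<inter> A K)" by (intro ad1) auto
    also have "\<dots> \<subseteq> span B1" by (intro span_mono) blast
    finally show ?thesis .
  qed
  have "U a \<inter> A K \<subseteq> span (B1 \<inter> U a)" if "a \<le> n" for a
    using ad1[OF that order_refl] span_mono[OF Int_lower1] by (rule subset_trans)
  then have "\<exists>B. B1 \<subseteq> B \<and> B \<subseteq> A (Suc K) \<and> independent B \<and>
      (\<forall>a\<le>n. U a \<inter> A (Suc K) \<subseteq> span (B \<inter> U a))"
    using B1 sp1 AK U by (intro extend_adapted_basis[of B1 "A K"])
  then obtain B where B: "B1 \<subseteq> B" "B \<subseteq> A (Suc K)" "independent B"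
    and ad: "\<And>a. a \<le> n \<Longrightarrow> U a \<inter> A (Suc K) \<subseteq> span (B \<inter> U a)"
    by blast
  have "U a \<inter> A j \<subseteq> span (B \<inter> U a \<inter> A j)" if "a \<le> n" "j \<le> Suc K" for a j
  proof (cases "j = Suc K")
    case True
    then have "B \<inter> U a \<inter> A j = B \<inter> U a" using B by auto
    then show ?thesis using ad that True by simp
  next
    case False
    then show ?thesis using ad1[of a j] that span_mono[of "B1 \<inter> U a \<inter> A j" "B \<inter> U a \<inter> A j"] B by auto
  qed
  then show ?case using B by blast
qed

end

section \<open>Counting\<close>

lemma card_fibres:
  assumes "finite T" "g ` T \<subseteq> {..k::nat}"
  shows "card T = (\<Sum>b\<le>k. card {x\<in>T. g x = b})"
  using sum.group[OF assms(1) _ assms(2), of "\<lambda>_. 1::nat"] by simp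

text \<open>Adding elements in the order of their levels makes the initial segments of all levels as large
  as the size of the subset permits.\<close>
lemma greedy_subset:
  fixes lev :: "'a \<Rightarrow> nat"
  assumes "finite A" "n \<le> card A"
  shows "\<exists>S\<subseteq>A. card S = n \<and> (\<forall>a. card {x\<in>S. lev x \<le> a} = min n (card {x\<in>A. lev x \<le> a}))"
  using assms(2)
proof (induction n)
  case 0
  then show ?case by (intro exI[of _ "{}"]) simp
next
  case (Suc n)
  then obtain S where S: "S \<subseteq> A" "card S = n"
    and lev: "\<And>a. card {x\<in>S. lev x \<le> a} = min n (card {x\<in>A. lev x \<le> a})" by auto
  have finS: "finite S" using S assms(1) finite_subset by blast
  have ne: "A - S \<noteq> {}" using S Suc.prems by auto
  define x where "x = arg_min_on lev (A - S)"
  have x: "x \<in> A - S" "\<And>y. y \<in> A - S \<Longrightarrow> lev x \<le> lev y"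
    using arg_min_if_finite(1)[of "A - S" lev] arg_min_least[of "A - S" _ lev] ne assms(1)
    by (auto simp: x_def)
  have "card {y\<in>insert x S. lev y \<le> a} = min (Suc n) (card {y\<in>A. lev y \<le> a})" for a
  proof (cases "lev x \<le> a")
    case True
    have eq: "{y\<in>insert x S. lev y \<le> a} = insert x {y\<in>S. lev y \<le> a}" using True by auto
    have "card {y\<in>insert x S. lev y \<le> a} = Suc (card {y\<in>S. lev y \<le> a})"
      unfolding eq using x finS by (subst card_insert_disjoint) auto
    moreover have "card {y\<in>S. lev y \<le> a} < card {y\<in>A. lev y \<le> a}"
      using x True S assms(1) by (intro psubset_card_mono) auto
    ultimately show ?thesis using lev[of a] by auto
  next
    case False
    then have "{y\<in>insert x S. lev y \<le> a} = {y\<in>S. lev y \<le> a}"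
      "{y\<in>A. lev y \<le> a} = {y\<in>S. lev y \<le> a}"
      using S x by (auto dest: x(2)) (metis le_trans)
    moreover have "card {y\<in>S. lev y \<le> a} \<le> n" using S(2) finS by (auto intro: card_mono)
    ultimately show ?thesis by simp
  qed
  then show ?case using S x finS by (intro exI[of _ "insert x S"]) auto
qed

section \<open>The induced maps on a stratum\<close>

lemma coset_eq_iff:
  assumes "vector_space sc" "module.subspace sc S"
  shows "(+) x ` S = (+) y ` S \<longleftrightarrow> x - y \<in> S"
proof -
  interpret vector_space sc by fact
  show ?thesis
  proof
    assume eq: "(+) x ` S = (+) y ` S"
    have "x \<in> (+) x ` S" using subspace_0[OF assms(2)] by (metis add.right_neutral image_eqI)
    then show "x - y \<in> S" unfolding eq by auto
  next
    have *: "(+) x ` S \<subseteq> (+) y ` S" if "x - y \<in> S" for x y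
    proof
      fix z assume "z \<in> (+) x ` S"
      then obtain s where "s \<in> S" "z = x + s" by auto
      then have "z = y + ((x - y) + s)" "(x - y) + s \<in> S"
        using that assms(2) by (auto intro: subspace_add)
      then show "z \<in> (+) y ` S" by blast
    qed
    assume xy: "x - y \<in> S"
    then have "y - x \<in> S" using subspace_neg[OF assms(2) xy] by simp
    then show "(+) x ` S = (+) y ` S" using * xy by (intro equalityI) auto
  qed
qed

lemma quot_memI: "x \<in> A \<Longrightarrow> (+) x ` C \<in> quot A C"
  unfolding quot_def by (rule imageI)

locale stratum = vector_space sc for sc :: "complex \<Rightarrow> 'e \<Rightarrow> 'e::ab_group_add" +
  fixes V :: "'e set" and f :: "('e, 'r::finite) hom_tuple" and l :: "nat \<Rightarrow> complex"
    and k :: nat and rr :: "nat \<Rightarrow> nat" and W :: "nat \<Rightarrow> 'e set"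
    and W' :: "nat \<Rightarrow> (complex ^ 'r) set" and v :: "nat \<Rightarrow> 'e set \<Rightarrow> (complex ^ 'r) set"
    and h :: "('e, 'r) hom_tuple"
  assumes hom_data: "hom_data sc V f l k rr W W' v h"
begin

lemma rr_ends: "rr 0 = 0" "rr (Suc k) = CARD('r)"
  and rr_Suc: "j \<le> k \<Longrightarrow> rr j < rr (Suc j)"
  and W_ends: "W 0 = V" "W (Suc k) = {0}"
  and W_Suc: "j \<le> k \<Longrightarrow> W (Suc j) \<subseteq> W j"
  and W_subspace: "j \<le> Suc k \<Longrightarrow> subspace (W j)"
  and W_dim: "j \<le> Suc k \<Longrightarrow> dim (W j) = CARD('r) - rr j"
  and W'_Suc: "j \<le> k \<Longrightarrow> W' j \<subseteq> W' (Suc j)"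
  and W'_subspace: "j \<le> Suc k \<Longrightarrow> vec.subspace (W' j)"
proof -
  have D: "rr 0 = 0 \<and> rr (k+1) = CARD('r) \<and> (\<forall>j\<le>k. rr j < rr (j+1)) \<and>
    W 0 = V \<and> W (k+1) = {0} \<and> (\<forall>j\<le>k. W (j+1) \<subset> W j) \<and>
    (\<forall>j\<le>k+1. subspace (W j) \<and> dim (W j) = CARD('r) - rr j) \<and>
    (\<forall>j\<le>k. W' j \<subset> W' (j+1)) \<and> (\<forall>j\<le>k+1. vec.subspace (W' j) \<and> vec.dim (W' j) = rr j)"
    using hom_data unfolding hom_data_def by (elim conjE) (intro conjI; assumption)
  show "rr 0 = 0" "rr (Suc k) = CARD('r)" "j \<le> k \<Longrightarrow> rr j < rr (Suc j)"
    "W 0 = V" "W (Suc k) = {0}" "j \<le> k \<Longrightarrow> W (Suc j) \<subseteq> W j" "j \<le> Suc k \<Longrightarrow> subspace (W j)"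
    "j \<le> Suc k \<Longrightarrow> dim (W j) = CARD('r) - rr j" "j \<le> k \<Longrightarrow> W' j \<subseteq> W' (Suc j)"
    "j \<le> Suc k \<Longrightarrow> vec.subspace (W' j)"
    using D by auto
qed

lemma quot_iso: "b \<le> k \<Longrightarrow> quot_iso sc (W b) (W (Suc b)) (W' (Suc b)) (W' b) (v (Suc b))"
proof -
  assume b: "b \<le> k"
  have "\<forall>j\<in>{1..k+1}. quot_iso sc (W (j-1)) (W j) (W' j) (W' (j-1)) (v j)"
    using hom_data unfolding hom_data_def by (elim conjE) assumption
  from bspec[OF this, of "Suc b"] show ?thesis using b by simp
qed

lemma induced: "1 \<le> i \<Longrightarrow> i \<le> CARD('r) \<Longrightarrow> induced_map sc k rr W W' v i (h i)"
proof -
  assume i: "1 \<le> i" "i \<le> CARD('r)"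
  have "\<forall>i\<in>{1..CARD('r)}. induced_map sc k rr W W' v i (h i) \<and>
      (\<forall>xs I. h i xs I = (\<Prod>j\<in>{1..<i} - rr ` {1..k}. l j ^ (i - j)) * f i xs I)"
    using hom_data unfolding hom_data_def by (elim conjE) assumption
  then show ?thesis using i by simp
qed

lemma h_ext_hom: "1 \<le> i \<Longrightarrow> i \<le> CARD('r) \<Longrightarrow> h i \<in> ext_hom sc V i"
  using induced[of i] unfolding induced_map_def W_ends by (rule conjunct1)

lemma h_eq_0_iff:
  assumes "1 \<le> i" "i \<le> CARD('r)"
  shows "h i xs = (\<lambda>I. 0) \<longleftrightarrow> f i xs = (\<lambda>I. 0)"
proof -
  have "h i xs I = (\<Prod>j\<in>{1..<i} - rr ` {1..k}. l j ^ (i - j)) * f i xs I" for I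
  proof -
    have "\<forall>i\<in>{1..CARD('r)}. induced_map sc k rr W W' v i (h i) \<and>
        (\<forall>xs I. h i xs I = (\<Prod>j\<in>{1..<i} - rr ` {1..k}. l j ^ (i - j)) * f i xs I)"
      using hom_data unfolding hom_data_def by (elim conjE) assumption
    then show ?thesis using assms by simp
  qed
  moreover have "\<forall>j\<in>{1..<CARD('r)}. l j = 0 \<longleftrightarrow> j \<in> rr ` {1..k}"
    using hom_data unfolding hom_data_def by (elim conjE) assumption
  then have "(\<Prod>j\<in>{1..<i} - rr ` {1..k}. l j ^ (i - j)) \<noteq> 0"
    using assms by (subst prod_zero_iff) auto
  ultimately show ?thesis by (simp add: fun_eq_iff)
qed

lemma rr_less: "i < j \<Longrightarrow> j \<le> Suc k \<Longrightarrow> rr i < rr j"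
proof (induction j)
  case (Suc j)
  then show ?case using rr_Suc[of j] by (cases "i = j") auto
qed simp

lemma rr_le: "i \<le> j \<Longrightarrow> j \<le> Suc k \<Longrightarrow> rr i \<le> rr j"
  using rr_less[of i j] by (cases "i = j") auto

lemma W_anti: "i \<le> j \<Longrightarrow> j \<le> Suc k \<Longrightarrow> W j \<subseteq> W i"
proof (induction j)
  case (Suc j)
  then show ?case using W_Suc[of j] by (cases "i = Suc j") auto
qed simp

lemma W'_mono: "i \<le> j \<Longrightarrow> j \<le> Suc k \<Longrightarrow> W' i \<subseteq> W' j"
proof (induction j)
  case (Suc j)
  then show ?case using W'_Suc[of j] by (cases "i = Suc j") auto
qed simp

lemma j_minus_plus:
  assumes "b \<le> k" "rr b < i" "i \<le> rr (Suc b)"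
  shows "j_minus k rr i = b" "j_plus k rr i = Suc b"
proof -
  show "j_minus k rr i = b" unfolding j_minus_def
  proof (rule Max_eqI)
    fix j assume "j \<in> {j \<in> {0..k}. rr j < i}"
    then show "j \<le> b" using assms rr_le[of "Suc b" j] by (cases "j \<le> b") auto
  qed (use assms in auto)
  show "j_plus k rr i = Suc b" unfolding j_plus_def
  proof (rule Min_eqI)
    fix j assume "j \<in> {j \<in> {0..k+1}. i \<le> rr j}"
    then show "Suc b \<le> j" using assms rr_le[of j b] by (cases "Suc b \<le> j") auto
  qed (use assms in auto)
qed

text \<open>Positions in a list are counted from 0, whence \<open>Suc p\<close>.\<close>
abbreviation pos :: "nat \<Rightarrow> nat" where "pos p \<equiv> j_minus k rr (Suc p)"

lemma pos:
  assumes "p < CARD('r)"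
  shows "pos p \<le> k" "rr (pos p) \<le> p" "p < rr (Suc (pos p))" "j_plus k rr (Suc p) = Suc (pos p)"
proof -
  define b where "b = (LEAST b. p < rr (Suc b))"
  have k: "p < rr (Suc k)" using assms rr_ends by simp
  have b: "p < rr (Suc b)" "b \<le> k" using LeastI[of "\<lambda>b. p < rr (Suc b)", OF k] Least_le[of "\<lambda>b. p < rr (Suc b)", OF k]
    by (auto simp: b_def)
  have "rr b \<le> p"
  proof (cases b)
    case 0 then show ?thesis using rr_ends by simp
  next
    case (Suc c)
    then have "\<not> p < rr (Suc c)" using not_less_Least[of c "\<lambda>b. p < rr (Suc b)"] by (simp add: b_def)
    then show ?thesis using Suc by simp
  qed
  then show "pos p \<le> k" "rr (pos p) \<le> p" "p < rr (Suc (pos p))" "j_plus k rr (Suc p) = Suc (pos p)"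
    using j_minus_plus[of b "Suc p"] b by auto
qed

lemma pos_eq: "b \<le> k \<Longrightarrow> rr b \<le> p \<Longrightarrow> p < rr (Suc b) \<Longrightarrow> pos p = b"
  using j_minus_plus[of b "Suc p"] by simp

lemma card_pos:
  assumes "i \<le> CARD('r)" "b \<le> k"
  shows "card {p. p < i \<and> pos p = b} = min i (rr (Suc b)) - min i (rr b)"
proof -
  have "{p. p < i \<and> pos p = b} = {min i (rr b)..<min i (rr (Suc b))}"
  proof (rule set_eqI)
    fix p
    have "pos p = b \<longleftrightarrow> rr b \<le> p \<and> p < rr (Suc b)" if "p < i"
      using pos[of p] pos_eq[OF assms(2), of p] assms(1) that by fastforce
    then show "p \<in> {p. p < i \<and> pos p = b} \<longleftrightarrow> p \<in> {min i (rr b)..<min i (rr (Suc b))}" by auto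
  qed
  then show ?thesis by simp
qed

text \<open>Blocks are numbered from 0: the block \<open>b\<close> belongs to the quotient of \<open>W b\<close> by \<open>W (Suc b)\<close>, which is
  the source of \<open>v (Suc b)\<close>.\<close>
definition block :: "'e \<Rightarrow> nat" where "block x = (LEAST b. x \<notin> W (Suc b))"

lemma block:
  assumes "x \<in> V" "x \<noteq> 0"
  shows "block x \<le> k" "j \<le> Suc k \<Longrightarrow> x \<in> W j \<longleftrightarrow> j \<le> block x"
proof -
  have k: "x \<notin> W (Suc k)" using assms W_ends by simp
  show le: "block x \<le> k" unfolding block_def using k by (rule Least_le)
  have out: "x \<notin> W (Suc (block x))" unfolding block_def using k by (rule LeastI)
  have "x \<in> W (block x)"
  proof (cases "block x")
    case 0 then show ?thesis using W_ends assms by simp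
  next
    case (Suc c)
    then show ?thesis using not_less_Least[of c "\<lambda>b. x \<notin> W (Suc b)"] by (simp add: block_def)
  qed
  then show "x \<in> W j \<longleftrightarrow> j \<le> block x" if "j \<le> Suc k"
    using W_anti[of j "block x"] W_anti[of "Suc (block x)" j] le out that
    by (cases "j \<le> block x") auto
qed

text \<open>Vectors \<open>x\<close> of \<open>W b\<close> and \<open>y\<close> of \<open>W' (Suc b)\<close> are said to match if \<open>v (Suc b)\<close> maps the class of \<open>x\<close>
  to the class of \<open>y\<close>.\<close>
lemma ex_matching:
  assumes "b \<le> k" "x \<in> W b"
  shows "\<exists>y\<in>W' (Suc b). v (Suc b) ((+) x ` W (Suc b)) = (+) y ` W' b"
proof -
  have "bij_betw (v (Suc b)) (quot (W b) (W (Suc b))) (quot (W' (Suc b)) (W' b))"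
    using quot_iso[OF assms(1)] unfolding quot_iso_def by (rule conjunct1)
  then have "v (Suc b) ((+) x ` W (Suc b)) \<in> quot (W' (Suc b)) (W' b)"
    by (rule bij_betw_apply) (rule quot_memI[OF assms(2)])
  then show ?thesis unfolding quot_def by (rule imageE) blast
qed

lemma matching_linear:
  assumes "b \<le> k" "x \<in> W b" "y \<in> W b" "x' \<in> W' (Suc b)" "y' \<in> W' (Suc b)"
    "v (Suc b) ((+) x ` W (Suc b)) = (+) x' ` W' b" "v (Suc b) ((+) y ` W (Suc b)) = (+) y' ` W' b"
  shows "v (Suc b) ((+) (sc c x + sc d y) ` W (Suc b)) = (+) (c *s x' + d *s y') ` W' b"
  by (rule quot_iso[OF assms(1), unfolded quot_iso_def, THEN conjunct2, rule_format]) (rule assms)+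

lemma matching_zero:
  assumes "b \<le> k"
  shows "v (Suc b) ((+) 0 ` W (Suc b)) = (+) 0 ` W' b"
proof -
  have "0 \<in> W b" using W_subspace assms by (simp add: subspace_0)
  moreover obtain y where "y \<in> W' (Suc b)" "v (Suc b) ((+) 0 ` W (Suc b)) = (+) y ` W' b"
    using ex_matching[OF assms \<open>0 \<in> W b\<close>] by blast
  ultimately show ?thesis using matching_linear[OF assms, of 0 0 y y 0 0] by simp
qed

lemma matching_sum:
  assumes b: "b \<le> k" and P: "finite P"
    "\<And>p. p \<in> P \<Longrightarrow> x p \<in> W b \<and> y p \<in> W' (Suc b) \<and> v (Suc b) ((+) (x p) ` W (Suc b)) = (+) (y p) ` W' b"
  shows "v (Suc b) ((+) (\<Sum>p\<in>P. sc (c p) (x p)) ` W (Suc b)) = (+) (\<Sum>p\<in>P. c p *s y p) ` W' b"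
  using P
proof (induction P rule: finite_induct)
  case empty
  then show ?case using matching_zero[OF b] by simp
next
  case (insert p P)
  have "(\<Sum>p\<in>P. sc (c p) (x p)) \<in> W b"
    using insert.prems W_subspace[of b] b by (intro subspace_sum subspace_scale) auto
  moreover have "(\<Sum>p\<in>P. c p *s y p) \<in> W' (Suc b)"
    using insert.prems W'_subspace[of "Suc b"] b by (intro vec.subspace_sum vec.subspace_scale) auto
  ultimately show ?case
    using matching_linear[OF b, of "x p" "\<Sum>p\<in>P. sc (c p) (x p)" "y p" "\<Sum>p\<in>P. c p *s y p" "c p" 1]
      insert by simp
qed

lemma matching_inj:
  assumes b: "b \<le> k" and x: "x \<in> W b" and y: "y \<in> W' b"
    and m: "v (Suc b) ((+) x ` W (Suc b)) = (+) y ` W' b"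
  shows "x \<in> W (Suc b)"
proof -
  have "(+) y ` W' b = (+) 0 ` W' b"
    using y b coset_eq_iff[OF vec.vector_space_axioms W'_subspace[of b], of y 0] by simp
  then have eq: "v (Suc b) ((+) x ` W (Suc b)) = v (Suc b) ((+) 0 ` W (Suc b))"
    using m matching_zero[OF b] by simp
  have 0: "0 \<in> W b" using W_subspace b by (simp add: subspace_0)
  have "inj_on (v (Suc b)) (quot (W b) (W (Suc b)))"
    using quot_iso[OF b] unfolding quot_iso_def by (blast dest: bij_betw_imp_inj_on)
  then have "(+) x ` W (Suc b) = (+) 0 ` W (Suc b)"
    using eq by (rule inj_onD) (intro quot_memI x 0)+
  then show ?thesis using coset_eq_iff[OF vector_space_axioms W_subspace[of "Suc b"], of x 0] b by simp
qed

lemma h_matching: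
  assumes i: "1 \<le> i" "i \<le> CARD('r)" and xs: "length xs = i" "\<And>p. p < i \<Longrightarrow> xs ! p \<in> W (pos p)"
    and ys: "length ys = i" "\<And>p. p < i \<Longrightarrow> ys ! p \<in> W' (Suc (pos p)) \<and>
      v (Suc (pos p)) ((+) (xs ! p) ` W (Suc (pos p))) = (+) (ys ! p) ` W' (pos p)"
  shows "h i xs = wedge ys"
proof (rule induced[OF i, unfolded induced_map_def, THEN conjunct2, rule_format])
  fix p assume p: "p < i"
  then have "j_plus k rr (Suc p) = Suc (pos p)" using pos(4) i by simp
  then show "xs ! p \<in> W (pos p) \<and> ys ! p \<in> W' (j_plus k rr (Suc p)) \<and>
      v (j_plus k rr (Suc p)) ((+) (xs ! p) ` W (j_plus k rr (Suc p))) = (+) (ys ! p) ` W' (pos p)"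
    using xs(2)[OF p] ys(2)[OF p] by simp
qed (fact xs ys)+

text \<open>One entry lies too deep in the flag: its class vanishes, so that the corresponding factor of
  the wedge product can be chosen to be 0.\<close>
lemma h_eq_0:
  assumes i: "1 \<le> i" "i \<le> CARD('r)" and xs: "length xs = i" "\<And>p. p < i \<Longrightarrow> xs ! p \<in> W (pos p)"
    and q: "q < i" "xs ! q \<in> W (Suc (pos q))"
  shows "h i xs = (\<lambda>I. 0)"
proof -
  have "\<forall>p<i. \<exists>y. y \<in> W' (Suc (pos p)) \<and>
      v (Suc (pos p)) ((+) (xs ! p) ` W (Suc (pos p))) = (+) y ` W' (pos p)"
    using ex_matching pos xs i by (metis order_less_le_trans)
  then obtain y where y: "\<And>p. p < i \<Longrightarrow> y p \<in> W' (Suc (pos p)) \<and>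
      v (Suc (pos p)) ((+) (xs ! p) ` W (Suc (pos p))) = (+) (y p) ` W' (pos p)" by metis
  have q': "pos q \<le> k" using pos i q by simp
  have "(+) (xs ! q) ` W (Suc (pos q)) = (+) 0 ` W (Suc (pos q))"
    using coset_eq_iff[OF vector_space_axioms W_subspace[of "Suc (pos q)"], of "xs ! q" 0] q q' by simp
  moreover have "0 \<in> W' (Suc (pos q))" using W'_subspace q' by (simp add: vec.subspace_0)
  ultimately have yq: "0 \<in> W' (Suc (pos q)) \<and>
      v (Suc (pos q)) ((+) (xs ! q) ` W (Suc (pos q))) = (+) 0 ` W' (pos q)"
    using matching_zero[OF q'] by metis
  have "h i xs = wedge (map (y(q := 0)) [0..<i])"
  proof (rule h_matching[OF i xs])
    fix p assume p: "p < i"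
    show "map (y(q := 0)) [0..<i] ! p \<in> W' (Suc (pos p)) \<and>
        v (Suc (pos p)) ((+) (xs ! p) ` W (Suc (pos p))) = (+) (map (y(q := 0)) [0..<i] ! p) ` W' (pos p)"
    proof (cases "p = q")
      case True
      then have "map (y(q := 0)) [0..<i] ! p = 0" using p by simp
      then show ?thesis unfolding True using yq by metis
    next
      case False
      then have "map (y(q := 0)) [0..<i] ! p = y p" using p by simp
      then show ?thesis using y[OF p] by metis
    qed
  qed simp_all
  moreover have "wedge (map (y(q := 0)) [0..<i]) = (\<lambda>I. 0)"
    using q by (intro wedge_zero_entry[of q]) auto
  ultimately show ?thesis by simp
qed

end

section \<open>Values of the induced maps on a basis adapted to \<open>W\<close>\<close>

locale stratum_basis = stratum sc V f l k rr W W' v h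
  for sc :: "complex \<Rightarrow> 'e \<Rightarrow> 'e::ab_group_add" and V and f :: "('e, 'r::finite) hom_tuple"
    and l k rr W W' v h +
  fixes B :: "'e set"
  assumes B: "independent B" "B \<subseteq> V" and W_span: "j \<le> Suc k \<Longrightarrow> W j \<subseteq> span (B \<inter> W j)"
begin

lemma B_nz: "x \<in> B \<Longrightarrow> x \<noteq> 0" using B dependent_zero by blast

lemmas block_B = block[OF subsetD[OF B(2)] B_nz]

lemma card_B_W: "j \<le> Suc k \<Longrightarrow> card (B \<inter> W j) = CARD('r) - rr j"
proof -
  assume j: "j \<le> Suc k"
  have "span (B \<inter> W j) = span (W j)"
    using W_span[OF j] W_subspace[OF j] by (metis inf_le2 span_eq span_span span_mono subset_antisym span_subspace)
  then have "dim (W j) = card (B \<inter> W j)"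
    using independent_mono[OF B(1)] by (intro dim_eq_card) auto
  then show ?thesis using W_dim[OF j] by simp
qed

lemma finite_B: "finite B" and card_B: "card B = CARD('r)"
proof -
  have "B \<inter> W 0 = B" using B W_ends by auto
  then show "card B = CARD('r)" using card_B_W[of 0] rr_ends by simp
  then show "finite B" by (metis card.infinite finite_UNIV_card_ge_0 finite less_numeral_extra(3))
qed

lemma card_block_le: "b \<le> k \<Longrightarrow> card {x\<in>B. block x \<le> b} = rr (Suc b)"
proof -
  assume b: "b \<le> k"
  have eq: "{x\<in>B. block x \<le> b} = B - B \<inter> W (Suc b)" using block_B(2) b by auto
  have "rr (Suc b) \<le> CARD('r)" using rr_le[of "Suc b" "Suc k"] b rr_ends by simp
  then show ?thesis unfolding eq using finite_B card_B card_B_W[of "Suc b"] b by (subst card_Diff_subset) auto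
qed

text \<open>The first \<open>p + 1\<close> entries of a sorted list are elements of \<open>B\<close> in blocks up to that of entry \<open>p\<close>,
  and there are only \<open>rr (Suc b)\<close> such elements in the blocks up to \<open>b\<close>.\<close>
lemma sorted_pos_le:
  assumes xs: "set xs \<subseteq> B" "distinct xs" "sorted (map block xs)" and p: "p < length xs"
  shows "pos p \<le> block (xs ! p)"
proof -
  let ?b = "block (xs ! p)"
  have b: "?b \<le> k" using block_B xs p nth_mem by blast
  have "length xs \<le> CARD('r)" using xs finite_B card_B by (metis card_mono distinct_card)
  then have pC: "p < CARD('r)" using p by simp
  have "(!) xs ` {..p} \<subseteq> {x\<in>B. block x \<le> ?b}"
    using xs p sorted_nth_mono[OF xs(3), of _ p] by auto
  then have "card ((!) xs ` {..p}) \<le> rr (Suc ?b)"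
    using card_mono[of "{x\<in>B. block x \<le> ?b}"] finite_B card_block_le[OF b] by auto
  moreover have "card ((!) xs ` {..p}) = Suc p"
    using xs p by (subst card_image) (auto simp: inj_on_def nth_eq_iff_index_eq)
  ultimately have "p < rr (Suc ?b)" by simp
  show ?thesis
  proof (rule ccontr)
    assume "\<not> ?thesis"
    then have "rr (Suc ?b) \<le> rr (pos p)" using pos[OF pC] by (intro rr_le) auto
    then show False using pos[OF pC] \<open>p < rr (Suc ?b)\<close> by simp
  qed
qed

lemma sorted_block_le_pos:
  assumes xs: "set xs \<subseteq> B" "distinct xs" "sorted (map block xs)" and p: "p < length xs"
   and count: "\<And>b. b \<le> k \<Longrightarrow> card {x\<in>set xs. block x \<le> b} = min (length xs) (rr (Suc b))"
  shows "block (xs ! p) \<le> pos p"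
proof (rule ccontr)
  assume less: "\<not> ?thesis"
  have "length xs \<le> CARD('r)" using xs finite_B card_B by (metis card_mono distinct_card)
  then have pC: "p < CARD('r)" using p by simp
  have "{x\<in>set xs. block x \<le> pos p} \<subseteq> (!) xs ` {..<p}"
  proof
    fix x assume "x \<in> {x\<in>set xs. block x \<le> pos p}"
    then obtain q where q: "q < length xs" "x = xs ! q" and bl: "block (xs ! q) \<le> pos p"
      by (auto simp: in_set_conv_nth)
    have "q < p"
    proof (rule ccontr)
      assume "\<not> q < p"
      then have "block (xs ! p) \<le> block (xs ! q)" using sorted_nth_mono[OF xs(3), of p q] q p by simp
      then show False using less bl by simp
    qed
    then show "x \<in> (!) xs ` {..<p}" using q by simp
  qed
  then have "card {x\<in>set xs. block x \<le> pos p} \<le> card {..<p}" by (intro surj_card_le) simp_all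
  then show False using count[of "pos p"] pos[OF pC] p by simp
qed

text \<open>The value is the wedge product of matching vectors. These are independent: in a relation
  between them, the part belonging to the highest block involved lies in \<open>W' b\<close>, so the same
  relation holds modulo \<open>W (Suc b)\<close> between elements of \<open>B\<close> outside \<open>W (Suc b)\<close>.\<close>
lemma h_sorted_nonzero:
  assumes i: "1 \<le> i" "i \<le> CARD('r)" "length xs = i"
    and xs: "set xs \<subseteq> B" "distinct xs" and bl: "\<And>p. p < i \<Longrightarrow> block (xs ! p) = pos p"
  shows "h i xs \<noteq> (\<lambda>I. 0)"
proof -
  have posk: "pos p \<le> k" if "p < i" for p using that i pos by simp
  have inW: "xs ! p \<in> W (pos p)" "xs ! p \<notin> W (Suc (pos p))" "xs ! p \<in> B" if p: "p < i" for p
  proof -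
    show "xs ! p \<in> B" using xs p i by auto
    then show "xs ! p \<in> W (pos p)" "xs ! p \<notin> W (Suc (pos p))"
      using block_B(2)[of "xs ! p"] bl[OF p] posk[OF p] by auto
  qed
  have "\<forall>p<i. \<exists>y. y \<in> W' (Suc (pos p)) \<and>
      v (Suc (pos p)) ((+) (xs ! p) ` W (Suc (pos p))) = (+) y ` W' (pos p)"
    using ex_matching posk inW by blast
  then obtain y where y: "\<And>p. p < i \<Longrightarrow> y p \<in> W' (Suc (pos p)) \<and>
      v (Suc (pos p)) ((+) (xs ! p) ` W (Suc (pos p))) = (+) (y p) ` W' (pos p)" by metis
  let ?ys = "map y [0..<i]"
  have "h i xs = wedge ?ys" using i inW y by (intro h_matching) auto
  moreover have "\<exists>I. length I = length ?ys \<and> wedge ?ys I \<noteq> 0"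
  proof (rule wedge_independent)
    fix c assume "(\<Sum>p<length ?ys. c p *s ?ys ! p) = 0"
    then have sum0: "(\<Sum>p<i. c p *s y p) = 0" by simp
    have "\<forall>p<i. c p = 0"
    proof (rule ccontr)
      assume "\<not> ?thesis"
      then have ne: "{p. p < i \<and> c p \<noteq> 0} \<noteq> {}" by auto
      define b where "b = Max (pos ` {p. p < i \<and> c p \<noteq> 0})"
      have "b \<in> pos ` {p. p < i \<and> c p \<noteq> 0}" unfolding b_def using ne by (intro Max_in) auto
      then obtain q where q: "q < i" "c q \<noteq> 0" "pos q = b" by auto
      have le: "pos p \<le> b" if "p < i" "c p \<noteq> 0" for p
        unfolding b_def using that by (intro Max_ge) auto
      have bk: "b \<le> k" using posk q by auto
      let ?P = "{p. p < i \<and> pos p = b}"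
      let ?Q = "{..<i} - ?P"
      have "(\<Sum>p\<in>?P. c p *s y p) = - (\<Sum>p\<in>?Q. c p *s y p)"
        using sum0 sum.subset_diff[of ?P "{..<i}" "\<lambda>p. c p *s y p"] by (simp add: eq_neg_iff_add_eq_0 add.commute subset_iff)
      moreover have "(\<Sum>p\<in>?Q. c p *s y p) \<in> W' b"
      proof (rule vec.subspace_sum)
        show "vec.subspace (W' b)" using W'_subspace bk by simp
        fix p assume p: "p \<in> ?Q"
        show "c p *s y p \<in> W' b"
        proof (cases "c p = 0")
          case True then show ?thesis using W'_subspace[of b] bk by (simp add: vec.subspace_0)
        next
          case False
          then have "Suc (pos p) \<le> b" using le[of p] p by auto
          then have "y p \<in> W' b" using y[of p] p W'_mono[of "Suc (pos p)" b] bk by auto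
          then show ?thesis using W'_subspace[of b] bk by (simp add: vec.subspace_scale)
        qed
      qed
      ultimately have "(\<Sum>p\<in>?P. c p *s y p) \<in> W' b"
        using vec.subspace_neg[OF W'_subspace[OF le_SucI[OF bk]]] by simp
      moreover have "v (Suc b) ((+) (\<Sum>p\<in>?P. sc (c p) (xs ! p)) ` W (Suc b))
          = (+) (\<Sum>p\<in>?P. c p *s y p) ` W' b"
        using y inW by (intro matching_sum[OF bk]) auto
      moreover have "(\<Sum>p\<in>?P. sc (c p) (xs ! p)) \<in> W b"
        using inW W_subspace[of b] bk by (intro subspace_sum subspace_scale) auto
      ultimately have "(\<Sum>p\<in>?P. sc (c p) (xs ! p)) \<in> W (Suc b)" using matching_inj[OF bk] by blast
      then have "(\<Sum>p\<in>?P. sc (c p) (xs ! p)) \<in> span (B \<inter> W (Suc b))" using W_span[of "Suc b"] bk by auto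
      then have "\<forall>p\<in>?P. c p = 0"
        using B(1) xs i inW
        by (intro independent_sum_in_span[of B "B \<inter> W (Suc b)"]) (auto simp: inj_on_def nth_eq_iff_index_eq)
      then show False using q by auto
    qed
    then show "\<forall>p<length ?ys. c p = 0" by simp
  qed
  ultimately show ?thesis by auto
qed

lemma h_sorted_nonzero_iff:
  assumes i: "1 \<le> i" "i \<le> CARD('r)" "length xs = i"
    and xs: "set xs \<subseteq> B" "distinct xs" "sorted (map block xs)"
  shows "h i xs \<noteq> (\<lambda>I. 0) \<longleftrightarrow> (\<forall>p<i. block (xs ! p) = pos p)"
proof
  assume nz: "h i xs \<noteq> (\<lambda>I. 0)"
  have ge: "pos p \<le> block (xs ! p)" if "p < i" for p
    using sorted_pos_le[OF xs, of p] that i(3) by simp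
  have mem: "xs ! p \<in> B" if "p < i" for p using xs(1) i(3) that nth_mem by blast
  have inW: "xs ! p \<in> W j \<longleftrightarrow> j \<le> block (xs ! p)" if "p < i" "j \<le> Suc k" for p j
    by (intro block_B(2) mem that)
  have posk: "pos p \<le> k" if "p < i" for p using that i pos(1)[of p] by simp
  have "\<not> Suc (pos q) \<le> block (xs ! q)" if q: "q < i" for q
  proof
    assume "Suc (pos q) \<le> block (xs ! q)"
    then have "xs ! q \<in> W (Suc (pos q))" using inW[OF q] posk[OF q] by simp
    moreover have "xs ! p \<in> W (pos p)" if "p < i" for p
      using inW[OF that] posk[OF that] ge[OF that] by simp
    ultimately have "h i xs = (\<lambda>I. 0)" by (intro h_eq_0[OF i _ q])
    then show False using nz by blast
  qed
  then show "\<forall>p<i. block (xs ! p) = pos p" using ge by (simp add: le_antisym not_less_eq_eq)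
qed (use h_sorted_nonzero[OF i xs(1,2)] in blast)

end

section \<open>Positions of the nonzero values relative to a flag\<close>

context stratum
begin

definition gr_dim :: "nat \<Rightarrow> 'e set \<Rightarrow> nat" where
  "gr_dim b S = dim (S \<inter> W b) - dim (S \<inter> W (Suc b))"

text \<open>The largest number of entries in \<open>S\<close> that a list can have on which \<open>h i\<close> does not vanish; the
  summand for \<open>b\<close> counts the entries in block \<open>b\<close>.\<close>
definition wedge_rank :: "nat \<Rightarrow> 'e set \<Rightarrow> nat" where
  "wedge_rank i S = (\<Sum>b\<le>k. min i (rr b + gr_dim b S) - min i (rr b))"

lemma V_subspace: "subspace V" using W_subspace[of 0] W_ends by simp

end

context stratum_basis
begin

lemma card_block:
  assumes b: "b \<le> k"
  shows "card {x\<in>B. block x = b} = rr (Suc b) - rr b"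
proof -
  have "{x\<in>B. block x = b} = B \<inter> W b - B \<inter> W (Suc b)"
    using block_B(2)[of _ b] block_B(2)[of _ "Suc b"] b by auto
  also have "card \<dots> = card (B \<inter> W b) - card (B \<inter> W (Suc b))"
    using finite_B W_Suc[OF b] by (intro card_Diff_subset) auto
  also have "\<dots> = rr (Suc b) - rr b"
    using card_B_W[of b] card_B_W[of "Suc b"] b rr_le[of "Suc b" "Suc k"] rr_le[of b "Suc k"] rr_ends(2)
    by simp
  finally show ?thesis .
qed

lemma dim_adapted:
  assumes "subspace S" "j \<le> Suc k" "S \<inter> W j \<subseteq> span (B \<inter> S \<inter> W j)"
  shows "dim (S \<inter> W j) = card (B \<inter> S \<inter> W j)"
proof (rule dim_eq_card)
  show "independent (B \<inter> S \<inter> W j)" by (rule independent_mono[OF B(1)]) blast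
  have "span (B \<inter> S \<inter> W j) \<subseteq> span (S \<inter> W j)" by (intro span_mono) blast
  moreover have "span (S \<inter> W j) \<subseteq> span (B \<inter> S \<inter> W j)" by (intro span_minimal assms subspace_span)
  ultimately show "span (B \<inter> S \<inter> W j) = span (S \<inter> W j)" by blast
qed

lemma card_block_adapted:
  assumes S: "subspace S" "\<And>j. j \<le> Suc k \<Longrightarrow> S \<inter> W j \<subseteq> span (B \<inter> S \<inter> W j)" and b: "b \<le> k"
  shows "card {x\<in>B \<inter> S. block x = b} = gr_dim b S"
proof -
  have "{x\<in>B \<inter> S. block x = b} = B \<inter> S \<inter> W b - B \<inter> S \<inter> W (Suc b)"
    using block_B(2)[of _ b] block_B(2)[of _ "Suc b"] b by auto
  also have "card \<dots> = card (B \<inter> S \<inter> W b) - card (B \<inter> S \<inter> W (Suc b))"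
    using finite_B W_Suc[OF b] by (intro card_Diff_subset) auto
  also have "\<dots> = gr_dim b S"
    using dim_adapted[OF S(1) _ S(2), of b] dim_adapted[OF S(1) _ S(2), of "Suc b"] b
    by (simp add: gr_dim_def)
  finally show ?thesis .
qed

lemma gr_dim_le:
  assumes S: "subspace S" "\<And>j. j \<le> Suc k \<Longrightarrow> S \<inter> W j \<subseteq> span (B \<inter> S \<inter> W j)" and b: "b \<le> k"
  shows "gr_dim b S \<le> rr (Suc b) - rr b"
proof -
  have "card {x\<in>B \<inter> S. block x = b} \<le> card {x\<in>B. block x = b}"
    using finite_B by (intro card_mono) auto
  then show ?thesis using card_block_adapted[OF S b] card_block[OF b] by simp
qed

end

locale stratum_flag_basis = stratum_basis sc V f l k rr W W' v h B
  for sc :: "complex \<Rightarrow> 'e \<Rightarrow> 'e::ab_group_add" and V and f :: "('e, 'r::finite) hom_tuple"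
    and l k rr W W' v h B +
  fixes U :: "nat \<Rightarrow> 'e set" and m :: nat
  assumes U_subspace: "a \<in> {1..Suc m} \<Longrightarrow> subspace (U a)"
    and U_mono: "1 \<le> a \<Longrightarrow> a \<le> b \<Longrightarrow> b \<le> Suc m \<Longrightarrow> U a \<subseteq> U b" and U_top: "U (Suc m) = V"
    and U_span: "a \<in> {1..Suc m} \<Longrightarrow> j \<le> Suc k \<Longrightarrow> U a \<inter> W j \<subseteq> span (B \<inter> U a \<inter> W j)"
begin

lemma U_sub_span: "a \<in> {1..Suc m} \<Longrightarrow> U a \<subseteq> span (B \<inter> U a)"
proof -
  assume a: "a \<in> {1..Suc m}"
  then have "U a \<subseteq> W 0" using U_mono[of a "Suc m"] U_top W_ends by auto
  then have "U a \<inter> W 0 = U a" "B \<inter> U a \<inter> W 0 = B \<inter> U a" by auto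
  then show ?thesis using U_span[OF a, of 0] by simp
qed

text \<open>By multilinearity the vectors may be taken from \<open>B\<close>. Then they contain exactly
  \<open>min i (rr (Suc b)) - min i (rr b)\<close> elements of block \<open>b\<close>, and at most \<open>gr_dim b (U a)\<close> of these can lie
  in \<open>U a\<close>.\<close>
lemma count_le_wedge_rank:
  assumes i: "1 \<le> i" "i \<le> CARD('r)" and ls: "\<And>p. p < i \<Longrightarrow> ls ! p \<in> {1..Suc m}"
    and xs: "\<And>p. p < i \<Longrightarrow> xs ! p \<in> U (ls ! p)" and nz: "h i xs \<noteq> (\<lambda>I. 0)" and a: "a \<in> {1..Suc m}"
  shows "card {p. p < i \<and> ls ! p \<le> a} \<le> wedge_rank i (U a)"
proof -
  note g = h_ext_hom[OF i] and vs = vector_space_axioms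
  obtain bs where bs: "length bs = i" "\<And>p. p < i \<Longrightarrow> bs ! p \<in> B \<inter> U (ls ! p)" "h i bs \<noteq> (\<lambda>I. 0)"
  proof (rule ext_hom_span[OF vs g V_subspace, of "\<lambda>p. B \<inter> U (ls ! p)" xs])
    show "B \<inter> U (ls ! p) \<subseteq> V \<and> xs ! p \<in> span (B \<inter> U (ls ! p))" if "p < i" for p
      using B(2) U_sub_span[OF ls[OF that]] xs[OF that] by blast
  qed (use nz in auto)
  have bsB: "set bs \<subseteq> B" using bs(1,2) by (auto simp: in_set_conv_nth)
  have dist: "distinct bs" by (rule ext_hom_distinct[OF g bs(3)])
  define cs where "cs = sort_key block bs"
  have cs: "set cs = set bs" "length cs = i" "distinct cs" "sorted (map block cs)" "mset bs = mset cs"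
    using bs(1) dist by (simp_all add: cs_def)
  have "h i cs \<noteq> (\<lambda>I. 0)" by (rule ext_hom_permute[OF vs g V_subspace bs(3) cs(5)])
  then have bl: "block (cs ! p) = pos p" if "p < i" for p
    using h_sorted_nonzero_iff[OF i cs(2) _ cs(3,4)] bsB cs(1) that by simp
  have blk: "card {x\<in>set bs. block x = b} = min i (rr (Suc b)) - min i (rr b)" if "b \<le> k" for b
  proof -
    have "{x\<in>set cs. block x = b} = (!) cs ` {p. p < i \<and> pos p = b}"
      using bl cs(2) by (auto simp: in_set_conv_nth)
    moreover have "inj_on ((!) cs) {p. p < i \<and> pos p = b}"
      using cs(2,3) by (auto simp: inj_on_def nth_eq_iff_index_eq)
    ultimately show ?thesis using card_pos[OF i(2) that] cs(1) by (simp add: card_image)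
  qed
  let ?T = "set bs \<inter> U a"
  have "card {p. p < i \<and> ls ! p \<le> a} \<le> card ?T"
  proof (rule card_inj_on_le)
    show "inj_on ((!) bs) {p. p < i \<and> ls ! p \<le> a}"
      using bs(1) dist by (auto simp: inj_on_def nth_eq_iff_index_eq)
    show "(!) bs ` {p. p < i \<and> ls ! p \<le> a} \<subseteq> ?T"
    proof (rule image_subsetI)
      fix p assume p: "p \<in> {p. p < i \<and> ls ! p \<le> a}"
      then have "U (ls ! p) \<subseteq> U a" using ls[of p] a by (intro U_mono) auto
      then show "bs ! p \<in> ?T" using bs(1,2) p by auto
    qed
  qed simp
  also have "\<dots> = (\<Sum>b\<le>k. card {x\<in>?T. block x = b})"
    using block_B(1) bsB by (intro card_fibres) auto
  also have "\<dots> \<le> wedge_rank i (U a)"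
    unfolding wedge_rank_def
  proof (rule sum_mono)
    fix b assume "b \<in> {..k}" then have b: "b \<le> k" by simp
    have "card {x\<in>?T. block x = b} \<le> card {x\<in>set bs. block x = b}" by (intro card_mono) auto
    moreover have "card {x\<in>?T. block x = b} \<le> card {x\<in>B \<inter> U a. block x = b}"
      using finite_B bsB by (intro card_mono) auto
    moreover note blk[OF b] card_block_adapted[OF U_subspace[OF a] U_span[OF a] b]
      gr_dim_le[OF U_subspace[OF a] U_span[OF a] b]
    ultimately show "card {x\<in>?T. block x = b} \<le> min i (rr b + gr_dim b (U a)) - min i (rr b)"
      by linarith
  qed
  finally show ?thesis .
qed

text \<open>In each block the prescribed number of basis vectors is chosen greedily with respect to their
  level in the flag \<open>U\<close>. This choice is independent of \<open>a\<close>, which is why all bounds are attained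
  by the same list.\<close>
lemma ex_count_eq_wedge_rank:
  assumes i: "1 \<le> i" "i \<le> CARD('r)"
  shows "\<exists>ls xs. length ls = i \<and> length xs = i \<and> (\<forall>p<i. ls ! p \<in> {1..Suc m} \<and> xs ! p \<in> U (ls ! p)) \<and>
    h i xs \<noteq> (\<lambda>I. 0) \<and> (\<forall>a\<in>{1..Suc m}. card {p. p < i \<and> ls ! p \<le> a} = wedge_rank i (U a))"
proof -
  define lev where "lev x = (LEAST a. 1 \<le> a \<and> x \<in> U a)" for x
  have lev: "lev x \<in> {1..Suc m} \<and> x \<in> U (lev x) \<and> (\<forall>a\<in>{1..Suc m}. lev x \<le> a \<longleftrightarrow> x \<in> U a)" if "x \<in> B" for x
  proof -
    have top: "1 \<le> Suc m \<and> x \<in> U (Suc m)" using that B(2) U_top by auto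
    have 1: "1 \<le> lev x \<and> x \<in> U (lev x)" unfolding lev_def using top by (rule LeastI)
    have 2: "lev x \<le> a" if "1 \<le> a" "x \<in> U a" for a unfolding lev_def using that by (intro Least_le) simp
    have "lev x \<le> Suc m" using 2 top by blast
    moreover have "x \<in> U a" if "lev x \<le> a" "a \<le> Suc m" for a using U_mono[of "lev x" a] 1 that by blast
    ultimately show ?thesis using 1 2 by auto
  qed
  define n where "n b = min i (rr (Suc b)) - min i (rr b)" for b
  have "\<forall>b\<in>{..k}. \<exists>S. S \<subseteq> {x\<in>B. block x = b} \<and> card S = n b \<and>
      (\<forall>a. card {x\<in>S. lev x \<le> a} = min (n b) (card {x\<in>{x\<in>B. block x = b}. lev x \<le> a}))"
  proof
    fix b assume "b \<in> {..k}"
    then have "n b \<le> card {x\<in>B. block x = b}" using card_block by (auto simp: n_def)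
    then show "\<exists>S. S \<subseteq> {x\<in>B. block x = b} \<and> card S = n b \<and>
      (\<forall>a. card {x\<in>S. lev x \<le> a} = min (n b) (card {x\<in>{x\<in>B. block x = b}. lev x \<le> a}))"
      using finite_B by (intro greedy_subset) simp_all
  qed
  from bchoice[OF this] obtain S where S: "\<And>b. b \<le> k \<Longrightarrow> S b \<subseteq> {x\<in>B. block x = b}"
      "\<And>b. b \<le> k \<Longrightarrow> card (S b) = n b"
      "\<And>b a. b \<le> k \<Longrightarrow> card {x\<in>S b. lev x \<le> a} = min (n b) (card {x\<in>{x\<in>B. block x = b}. lev x \<le> a})"
    unfolding Ball_def atMost_iff by blast
  define T where "T = (\<Union>b\<le>k. S b)"
  have TB: "T \<subseteq> B" using S(1) by (auto simp: T_def)
  then have finT: "finite T" using finite_B finite_subset by blast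
  have Tb: "{x\<in>T. block x = b} = S b" if "b \<le> k" for b
    using S(1) that by (auto simp: T_def)
  have tele: "(\<Sum>b\<le>c. n b) = min i (rr (Suc c))" if "c \<le> k" for c
    using that
  proof (induction c)
    case 0
    then show ?case using rr_ends by (simp add: n_def)
  next
    case (Suc c)
    then show ?case using rr_Suc[of "Suc c"] by (simp add: n_def)
  qed
  have cntT: "card {x\<in>T. block x \<le> c} = min i (rr (Suc c))" if c: "c \<le> k" for c
  proof -
    have "card {x\<in>T. block x \<le> c} = (\<Sum>b\<le>c. card {x\<in>{x\<in>T. block x \<le> c}. block x = b})"
      using finT by (intro card_fibres) auto
    also have "\<dots> = (\<Sum>b\<le>c. n b)"
    proof (rule sum.cong[OF refl])
      fix b assume "b \<in> {..c}"
      then have "{x\<in>{x\<in>T. block x \<le> c}. block x = b} = {x\<in>T. block x = b}" "b \<le> k" using c by auto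
      then show "card {x\<in>{x\<in>T. block x \<le> c}. block x = b} = n b" using Tb S(2) by simp
    qed
    finally show ?thesis using tele[OF c] by simp
  qed
  obtain ts where ts: "set ts = T" "distinct ts" using finite_distinct_list[OF finT] by blast
  define xs where "xs = sort_key block ts"
  have xs: "set xs = T" "distinct xs" "sorted (map block xs)" using ts by (simp_all add: xs_def)
  have "{x\<in>T. block x \<le> k} = T" using block_B(1) TB by blast
  then have len: "length xs = i" using cntT[of k] xs distinct_card[of xs] rr_ends i by simp
  have "block (xs ! p) = pos p" if "p < i" for p
    using sorted_pos_le[OF _ xs(2,3), of p] sorted_block_le_pos[OF _ xs(2,3), of p] xs(1) TB cntT that len
    by (simp add: le_antisym)
  then have nz: "h i xs \<noteq> (\<lambda>I. 0)" using h_sorted_nonzero_iff[OF i len _ xs(2,3)] xs(1) TB by simp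
  have "card {p. p < i \<and> map lev xs ! p \<le> a} = wedge_rank i (U a)" if a: "a \<in> {1..Suc m}" for a
  proof -
    have img: "(!) xs ` {p. p < i \<and> map lev xs ! p \<le> a} = {x\<in>T. lev x \<le> a}"
      using len xs(1) by (auto simp: in_set_conv_nth)
    have inj: "inj_on ((!) xs) {p. p < i \<and> map lev xs ! p \<le> a}"
      using len xs(2) by (auto simp: inj_on_def nth_eq_iff_index_eq)
    have "card {p. p < i \<and> map lev xs ! p \<le> a} = card {x\<in>T. lev x \<le> a}"
      using card_image[OF inj] unfolding img by (rule sym)
    also have "\<dots> = (\<Sum>b\<le>k. card {x\<in>{x\<in>T. lev x \<le> a}. block x = b})"
      using finT TB block_B(1) by (intro card_fibres) auto
    also have "\<dots> = wedge_rank i (U a)"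
      unfolding wedge_rank_def
    proof (rule sum.cong[OF refl])
      fix b assume "b \<in> {..k}" then have b: "b \<le> k" by simp
      have "{x\<in>{x\<in>T. lev x \<le> a}. block x = b} = {x\<in>S b. lev x \<le> a}" using Tb[OF b] by auto
      moreover have "{x\<in>{x\<in>B. block x = b}. lev x \<le> a} = {x\<in>B \<inter> U a. block x = b}" using lev a by auto
      ultimately have "card {x\<in>{x\<in>T. lev x \<le> a}. block x = b} = min (n b) (gr_dim b (U a))"
        using S(3)[OF b, of a] card_block_adapted[OF U_subspace[OF a] U_span[OF a] b] by simp
      also have "\<dots> = min i (rr b + gr_dim b (U a)) - min i (rr b)"
        using gr_dim_le[OF U_subspace[OF a] U_span[OF a] b] by (auto simp: n_def min_def)
      finally show "card {x\<in>{x\<in>T. lev x \<le> a}. block x = b} = min i (rr b + gr_dim b (U a)) - min i (rr b)" .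
    qed
    finally show ?thesis .
  qed
  moreover have "map lev xs ! p \<in> {1..Suc m} \<and> xs ! p \<in> U (map lev xs ! p)" if "p < i" for p
  proof -
    have "xs ! p \<in> B" using that len xs(1) TB nth_mem by blast
    moreover have "map lev xs ! p = lev (xs ! p)" using that len by simp
    ultimately show ?thesis using lev by metis
  qed
  ultimately show ?thesis using len nz by (intro exI[of _ "map lev xs"] exI[of _ xs]) simp
qed

end

context stratum
begin

text \<open>The filtration by which a basis is built up has to start at 0 and ascend, whence \<open>W\<close> is traversed
  backwards; the index of \<open>U\<close> is shifted because a weighted flag starts at 1.\<close>
lemma ex_flag_basis:
  fixes m :: nat
  assumes U: "\<And>a. a \<in> {1..Suc m} \<Longrightarrow> subspace (U a)"
    "\<And>a b. 1 \<le> a \<Longrightarrow> a \<le> b \<Longrightarrow> b \<le> Suc m \<Longrightarrow> U a \<subseteq> U b" "U (Suc m) = V"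
  shows "\<exists>B. stratum_flag_basis sc V f l k rr W W' v h B U m"
proof -
  have "\<exists>B. B \<subseteq> W (Suc k - Suc k) \<and> independent B \<and>
      (\<forall>a\<le>m. \<forall>j\<le>Suc k. U (Suc a) \<inter> W (Suc k - j) \<subseteq> span (B \<inter> U (Suc a) \<inter> W (Suc k - j)))"
    using U W_ends W_subspace
    by (intro adapted_basis) (auto simp: Suc_diff_le intro: W_Suc[THEN subsetD])
  then obtain B where B: "B \<subseteq> V" "independent B" and
    sp: "\<And>a j. a \<le> m \<Longrightarrow> j \<le> Suc k \<Longrightarrow> U (Suc a) \<inter> W (Suc k - j) \<subseteq> span (B \<inter> U (Suc a) \<inter> W (Suc k - j))"
    using W_ends by auto
  have sp': "U a \<inter> W j \<subseteq> span (B \<inter> U a \<inter> W j)" if "a \<in> {1..Suc m}" "j \<le> Suc k" for a j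
    using sp[of "a - 1" "Suc k - j"] that by (cases a) auto
  have "W j \<subseteq> span (B \<inter> W j)" if "j \<le> Suc k" for j
  proof -
    have "W j \<subseteq> V" using W_anti[of 0 j] that W_ends by simp
    then have "V \<inter> W j = W j" "B \<inter> V \<inter> W j = B \<inter> W j" by auto
    then show ?thesis using sp'[of "Suc m" j] that U(3) by simp
  qed
  then have "stratum_flag_basis sc V f l k rr W W' v h B U m"
    using B sp' U by unfold_locales auto
  then show ?thesis by blast
qed

end

section \<open>The weight of a flag and the criterion\<close>

lemma dim_fibre:
  assumes "vector_bundle X n E" "x \<in> X"
  shows "vector_space.dim (smul E) (fibre E x) = n"
proof -
  interpret vector_space "smul E" using assms(1) unfolding vector_bundle_def by blast
  obtain U e where "x \<in> U" "local_frame X n E U e"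
    using assms unfolding vector_bundle_def by blast
  then have e: "inj_on (\<lambda>i. e i x) {..<n}" "independent ((\<lambda>i. e i x) ` {..<n})"
    "span ((\<lambda>i. e i x) ` {..<n}) = fibre E x"
    unfolding local_frame_def by blast+
  then have "dim (fibre E x) = card ((\<lambda>i. e i x) ` {..<n})"
    using dim_span_eq_card_independent by metis
  then show ?thesis using e(1) by (simp add: card_image)
qed

text \<open>Uniqueness of the rank needs a point: a bundle over the empty set has every rank.\<close>
lemma bundle_rank_eq_dim:
  assumes "vector_bundle X n E" "x \<in> X"
  shows "bundle_rank X E = vector_space.dim (smul E) (fibre E x)"
  unfolding bundle_rank_def using assms dim_fibre by (intro the_equality) fastforce+

lemma subbundle_fibre:
  assumes "subbundle X E F" "x \<in> X"
  shows "module.subspace (smul E) (F x)" "sub_rank X E F = vector_space.dim (smul E) (F x)"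
proof -
  obtain n where n: "vector_bundle X n (restrict_bundle E F)" using assms unfolding subbundle_def by blast
  have s: "smul (restrict_bundle E F) = smul E" "fibre (restrict_bundle E F) = F"
    by (simp_all add: restrict_bundle_def)
  show "module.subspace (smul E) (F x)"
    using n assms(2) unfolding vector_bundle_def s by blast
  show "sub_rank X E F = vector_space.dim (smul E) (F x)"
    using bundle_rank_eq_dim[OF n assms(2)] unfolding s .
qed

text \<open>The sum depends on \<open>ls\<close> only through the numbers of entries bounded by \<open>j\<close>, each of them with
  coefficient \<open>- \<alpha> j\<close> times the rank.\<close>
lemma sum_gamma:
  assumes "\<And>p. p < i \<Longrightarrow> 1 \<le> ls ! p"
  shows "(\<Sum>p<i. gamma X E m Es \<alpha> (ls ! p)) =
    (\<Sum>j=1..m. \<alpha> j * (of_nat i * of_nat (sub_rank X E (Es j))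
       - of_nat (bundle_rank X E) * of_nat (card {p. p < i \<and> ls ! p \<le> j})))"
proof -
  have tail: "(\<Sum>j=a..m. \<alpha> j) = (\<Sum>j=1..m. if a \<le> j then \<alpha> j else 0)" if "1 \<le> a" for a
    using that by (intro sum.mono_neutral_cong_left) auto
  have "(\<Sum>p<i. \<Sum>j=ls ! p..m. \<alpha> j) = (\<Sum>p<i. \<Sum>j=1..m. if ls ! p \<le> j then \<alpha> j else 0)"
    by (rule sum.cong[OF refl]) (rule tail, rule assms, simp)
  also have "\<dots> = (\<Sum>j=1..m. \<Sum>p<i. if ls ! p \<le> j then \<alpha> j else 0)" by (rule sum.swap)
  also have "\<dots> = (\<Sum>j=1..m. \<alpha> j * of_nat (card {p. p < i \<and> ls ! p \<le> j}))"
  proof (rule sum.cong[OF refl])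
    fix j
    have "(\<Sum>p<i. if ls ! p \<le> j then \<alpha> j else 0) = (\<Sum>p\<in>{p\<in>{..<i}. ls ! p \<le> j}. \<alpha> j)"
      by (rule sum.inter_filter[symmetric]) simp
    then show "(\<Sum>p<i. if ls ! p \<le> j then \<alpha> j else 0) = \<alpha> j * of_nat (card {p. p < i \<and> ls ! p \<le> j})"
      by simp
  qed
  finally have "(\<Sum>p<i. \<Sum>j=ls ! p..m. \<alpha> j) = (\<Sum>j=1..m. \<alpha> j * of_nat (card {p. p < i \<and> ls ! p \<le> j}))" .
  then show ?thesis
    unfolding gamma_def
    by (simp add: sum_subtractf right_diff_distrib sum_distrib_left[symmetric])
      (simp add: sum_distrib_left mult_ac)
qed

lemma weighted_flag_chain:
  assumes wf: "weighted_flag X E m Es \<alpha>" and x: "x \<in> X" and "1 \<le> a" "a \<le> b" "b \<le> Suc m"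
  shows "Es a x \<subseteq> Es b x"
  using assms(4,5)
proof (induction b rule: dec_induct)
  case (step b)
  then show ?case using wf x \<open>1 \<le> a\<close> unfolding weighted_flag_def strictly_in_def by fastforce
qed simp

lemma weighted_flag_member:
  assumes wf: "weighted_flag X E m Es \<alpha>" and j: "j \<in> {1..m}"
  shows "subbundle X E (Es j)" "\<alpha> j > 0" "strictly_in X (\<lambda>x. {0}) (Es j)" "strictly_in X (Es j) (fibre E)"
proof -
  show "subbundle X E (Es j)" "\<alpha> j > 0" using wf j unfolding weighted_flag_def by auto
  have "strictly_in X (\<lambda>x. {0}) (Es 1)" using wf unfolding weighted_flag_def by blast
  then show "strictly_in X (\<lambda>x. {0}) (Es j)"
    using weighted_flag_chain[OF wf, of _ 1 j] j unfolding strictly_in_def by fastforce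
  have step: "strictly_in X (Es j) (Es (j+1))" and top: "\<forall>x\<in>X. Es (m+1) x = fibre E x"
    using wf j unfolding weighted_flag_def by blast+
  have sub: "Es (j+1) x \<subseteq> fibre E x" if "x \<in> X" for x
    using weighted_flag_chain[OF wf that, of "j+1" "Suc m"] top that j by simp
  have "Es j x \<noteq> fibre E x" if "x \<in> X" "Es j x \<subseteq> Es (j+1) x" "Es j x \<noteq> Es (j+1) x" for x
    using sub[OF that(1)] that(2,3) by blast
  then show "strictly_in X (Es j) (fibre E)"
    using step sub unfolding strictly_in_def by (meson subset_trans)
qed

lemma one_step_flag:
  assumes "subbundle X E F" "strictly_in X (\<lambda>x. {0}) F" "strictly_in X F (fibre E)"
  shows "weighted_flag X E 1 (\<lambda>j. if j = 1 then F else fibre E) (\<lambda>_. 1)"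
  using assms unfolding weighted_flag_def by simp

text \<open>The bound on \<open>t\<close> matters: beyond \<open>r\<close> the first sum in the definition of \<open>q_fun\<close> would run over
  indices \<open>i > r\<close>.\<close>
lemma q_fun_eq:
  assumes "t \<le> r"
  shows "q_fun r \<theta> t = (\<Sum>i=1..r. of_nat (\<theta> i) * of_nat (min i t))
     - of_nat t / of_nat r * (\<Sum>i=1..r. of_nat (\<theta> i) * of_nat i)"
proof -
  have "(\<Sum>i=1..r. of_nat (\<theta> i) * of_nat (min i t) :: rat)
      = (\<Sum>i=1..t. of_nat (\<theta> i) * of_nat (min i t)) + (\<Sum>i=t+1..r. of_nat (\<theta> i) * of_nat (min i t))"
    using assms sum.ub_add_nat[of 1 t "\<lambda>i. of_nat (\<theta> i) * of_nat (min i t) :: rat" "r - t"] by simp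
  also have "(\<Sum>i=1..t. of_nat (\<theta> i) * of_nat (min i t) :: rat) = (\<Sum>i=1..t. of_nat (\<theta> i) * of_nat i)"
    by (intro sum.cong) auto
  also have "(\<Sum>i=t+1..r. of_nat (\<theta> i) * of_nat (min i t) :: rat) = (\<Sum>i=t+1..r. of_nat (\<theta> i) * of_nat t)"
    by (intro sum.cong) auto
  finally show ?thesis by (simp add: q_fun_def)
qed

context stratum
begin

text \<open>The jumps \<open>gr_dim b S\<close> add up to \<open>dim S\<close>, so that the linear part of \<open>q_fun\<close> contributes the terms
  \<open>i * dim S\<close>; and \<open>rr b + gr_dim b S\<close> never exceeds the rank, so that \<open>q_fun_eq\<close> applies. Both
  are read off from a basis adapted to \<open>W\<close> and to the one-step flag \<open>S \<subseteq> V\<close>.\<close>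
lemma flag_term_eq:
  assumes S: "subspace S" "S \<subseteq> V"
  shows "of_nat CARD('r) * flag_term sc CARD('r) \<theta> k rr W S =
    (\<Sum>i=1..CARD('r). of_nat (\<theta> i) *
       (of_nat CARD('r) * of_nat (wedge_rank i S) - of_nat i * of_nat (dim S)))"
proof -
  let ?r = "CARD('r)"
  have "\<exists>B. stratum_flag_basis sc V f l k rr W W' v h B (\<lambda>a. if a = Suc 0 then S else V) 1"
    by (rule ex_flag_basis) (use S V_subspace in \<open>auto split: if_splits\<close>)
  then obtain B where "stratum_flag_basis sc V f l k rr W W' v h B (\<lambda>a. if a = Suc 0 then S else V) 1" ..
  then interpret stratum_flag_basis sc V f l k rr W W' v h B "\<lambda>a. if a = Suc 0 then S else V" 1 .
  have span: "S \<inter> W j \<subseteq> span (B \<inter> S \<inter> W j)" if "j \<le> Suc k" for j using U_span[of 1 j] that by simp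
  note gle = gr_dim_le[OF S(1) span]
  have bound: "rr b + gr_dim b S \<le> ?r" "rr b \<le> ?r" if "b \<le> k" for b
    using gle[OF _ that] rr_Suc[OF that] rr_le[of "Suc b" "Suc k"] that rr_ends(2) by auto
  have "dim S = (\<Sum>b\<le>k. gr_dim b S)"
  proof -
    have "S \<inter> W 0 = S" "B \<inter> S \<inter> W 0 = B \<inter> S" using S W_ends B by auto
    then have "dim S = card (B \<inter> S)" using dim_adapted[OF S(1) _ span, of 0] by simp
    also have "\<dots> = (\<Sum>b\<le>k. card {x\<in>B \<inter> S. block x = b})"
      using finite_B block_B(1) by (intro card_fibres) auto
    also have "\<dots> = (\<Sum>b\<le>k. gr_dim b S)" using card_block_adapted[OF S(1) span] by simp
    finally show ?thesis .
  qed
  then have dimS: "(of_nat (dim S) :: rat) = (\<Sum>b\<le>k. of_nat (gr_dim b S))" by simp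
  let ?Q = "\<Sum>i=1..?r. of_nat (\<theta> i) * of_nat i :: rat"
  have img: "rr ` {1..k+1} = (\<lambda>b. rr (Suc b)) ` {..k}"
    by (auto simp: image_iff) (metis Suc_le_D Suc_le_mono atMost_iff)
  have inj: "inj_on (\<lambda>b. rr (Suc b)) {..k}"
  proof (rule inj_onI)
    fix a b assume "a \<in> {..k}" "b \<in> {..k}" "rr (Suc a) = rr (Suc b)"
    then show "a = b" using rr_less[of "Suc a" "Suc b"] rr_less[of "Suc b" "Suc a"]
      by (cases a b rule: linorder_cases) auto
  qed
  have jm: "j_minus k rr (rr (Suc b)) = b" "j_plus k rr (rr (Suc b)) = Suc b" if "b \<le> k" for b
    using j_minus_plus[OF that, of "rr (Suc b)"] rr_Suc[OF that] by auto
  have "flag_term sc ?r \<theta> k rr W S = (\<Sum>b\<le>k. q_fun ?r \<theta> (rr b + gr_dim b S) - q_fun ?r \<theta> (rr b))"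
    unfolding flag_term_def img sum.reindex[OF inj] using jm
    by (intro sum.cong) (auto simp: gr_dim_def)
  also have "\<dots> = (\<Sum>b\<le>k. (\<Sum>i=1..?r. of_nat (\<theta> i) * of_nat (min i (rr b + gr_dim b S) - min i (rr b)))
      - of_nat (gr_dim b S) / of_nat ?r * ?Q)"
  proof (rule sum.cong[OF refl])
    fix b assume "b \<in> {..k}" then have b: "b \<le> k" by simp
    show "q_fun ?r \<theta> (rr b + gr_dim b S) - q_fun ?r \<theta> (rr b) =
      (\<Sum>i=1..?r. of_nat (\<theta> i) * of_nat (min i (rr b + gr_dim b S) - min i (rr b)))
      - of_nat (gr_dim b S) / of_nat ?r * ?Q"
      unfolding q_fun_eq[OF bound(1)[OF b]] q_fun_eq[OF bound(2)[OF b]]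
      by (simp add: of_nat_diff right_diff_distrib sum_subtractf add_divide_distrib distrib_right)
  qed
  also have "\<dots> = (\<Sum>i=1..?r. of_nat (\<theta> i) * of_nat (wedge_rank i S)) - of_nat (dim S) / of_nat ?r * ?Q"
  proof -
    have "(\<Sum>b\<le>k. \<Sum>i=1..?r. of_nat (\<theta> i) * of_nat (min i (rr b + gr_dim b S) - min i (rr b)) :: rat)
        = (\<Sum>i=1..?r. of_nat (\<theta> i) * of_nat (wedge_rank i S))"
      unfolding wedge_rank_def of_nat_sum sum_distrib_left by (rule sum.swap)
    then show ?thesis
      unfolding sum_subtractf dimS by (simp add: sum_distrib_right sum_divide_distrib)
  qed
  finally have "flag_term sc ?r \<theta> k rr W S =
    (\<Sum>i=1..?r. of_nat (\<theta> i) * of_nat (wedge_rank i S)) - of_nat (dim S) / of_nat ?r * ?Q" .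
  then have "of_nat ?r * flag_term sc ?r \<theta> k rr W S =
    of_nat ?r * (\<Sum>i=1..?r. of_nat (\<theta> i) * of_nat (wedge_rank i S)) - of_nat (dim S) * ?Q"
    by (simp add: right_diff_distrib)
  also have "\<dots> = (\<Sum>i=1..?r. of_nat (\<theta> i) *
       (of_nat ?r * of_nat (wedge_rank i S) - of_nat i * of_nat (dim S)))"
    by (simp add: sum_distrib_left sum_subtractf right_diff_distrib mult_ac)
  finally show ?thesis .
qed

text \<open>The list that attains all the bounds \<open>wedge_rank i (Es j x0)\<close> minimizes every summand of the formula
  \<open>sum_gamma\<close> separately, whatever the positive weights are.\<close>
lemma mu_eq:
  fixes E :: "('n::finite, 'e) vbundle"
  assumes E: "smul E = sc" "fibre E x0 = V" "bundle_rank X E = CARD('r)" and x0: "x0 \<in> X"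
    and wf: "weighted_flag X E m Es \<alpha>" and i: "1 \<le> i" "i \<le> CARD('r)"
  shows "mu X x0 E m Es \<alpha> i (f i) = (\<Sum>j=1..m. \<alpha> j *
    (of_nat CARD('r) * of_nat (wedge_rank i (Es j x0)) - of_nat i * of_nat (sub_rank X E (Es j))))"
proof -
  have top: "Es (Suc m) x0 = V" using wf x0 E unfolding weighted_flag_def by simp
  have "subspace (Es a x0)" if "a \<in> {1..Suc m}" for a
    using that top V_subspace subbundle_fibre(1)[OF weighted_flag_member(1)[OF wf, of a] x0] E(1)
    by (cases "a = Suc m") auto
  then have "\<exists>B. stratum_flag_basis sc V f l k rr W W' v h B (\<lambda>a. Es a x0) m"
    by (rule ex_flag_basis) (use weighted_flag_chain[OF wf x0] top in auto)
  then obtain B where "stratum_flag_basis sc V f l k rr W W' v h B (\<lambda>a. Es a x0) m" ..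
  then interpret stratum_flag_basis sc V f l k rr W W' v h B "\<lambda>a. Es a x0" m .
  let ?P = "\<lambda>ls. length ls = i \<and> set ls \<subseteq> {1..m+1} \<and>
     (\<exists>xs. length xs = i \<and> (\<forall>p<i. xs ! p \<in> Es (ls ! p) x0) \<and> f i xs \<noteq> (\<lambda>I. 0))"
  let ?s = "\<lambda>ls. \<Sum>p<i. gamma X E m Es \<alpha> (ls ! p)"
  let ?min = "\<Sum>j=1..m. \<alpha> j * (of_nat i * of_nat (sub_rank X E (Es j))
       - of_nat CARD('r) * of_nat (wedge_rank i (Es j x0)))"
  have val: "?s ls = (\<Sum>j=1..m. \<alpha> j * (of_nat i * of_nat (sub_rank X E (Es j))
       - of_nat CARD('r) * of_nat (card {p. p < i \<and> ls ! p \<le> j})))" if "\<And>p. p < i \<Longrightarrow> 1 \<le> ls ! p" for ls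
    unfolding E(3)[symmetric] by (rule sum_gamma) (rule that)
  have "Min {?s ls | ls. ?P ls} = ?min"
  proof (rule Min_eqI)
    have "finite {ls. set ls \<subseteq> {1..m+1} \<and> length ls = i}" by (rule finite_lists_length_eq) simp
    then have "finite (?s ` {ls. set ls \<subseteq> {1..m+1} \<and> length ls = i})" by (rule finite_imageI)
    then show "finite {?s ls | ls. ?P ls}" by (rule rev_finite_subset) blast
  next
    fix y assume "y \<in> {?s ls | ls. ?P ls}"
    then obtain ls xs where y: "y = ?s ls" and ls: "length ls = i" "set ls \<subseteq> {1..m+1}"
      and xs: "\<forall>p<i. xs ! p \<in> Es (ls ! p) x0" "f i xs \<noteq> (\<lambda>I. 0)" by blast
    have lsp: "ls ! p \<in> {1..Suc m}" if "p < i" for p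
      using subsetD[OF ls(2) nth_mem, of p] ls(1) that by simp
    have "card {p. p < i \<and> ls ! p \<le> j} \<le> wedge_rank i (Es j x0)" if "j \<in> {1..m}" for j
      using xs h_eq_0_iff[OF i, of xs] that
      by (intro count_le_wedge_rank[OF i lsp, of xs]) auto
    note card_le = this
    have "?min \<le> (\<Sum>j=1..m. \<alpha> j * (of_nat i * of_nat (sub_rank X E (Es j))
       - of_nat CARD('r) * of_nat (card {p. p < i \<and> ls ! p \<le> j})))"
    proof (rule sum_mono, rule mult_left_mono)
      fix j assume j: "j \<in> {1..m}"
      have "of_nat (card {p. p < i \<and> ls ! p \<le> j}) \<le> (of_nat (wedge_rank i (Es j x0)) :: rat)"
        using card_le[OF j] by (simp only: of_nat_le_iff)
      then show "of_nat i * of_nat (sub_rank X E (Es j)) - of_nat CARD('r) * of_nat (wedge_rank i (Es j x0))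
          \<le> (of_nat i * of_nat (sub_rank X E (Es j))
             - of_nat CARD('r) * of_nat (card {p. p < i \<and> ls ! p \<le> j}) :: rat)"
        by (intro diff_left_mono mult_left_mono) simp_all
      show "0 \<le> \<alpha> j" using weighted_flag_member(2)[OF wf j] by simp
    qed
    also have "\<dots> = ?s ls" by (rule val[symmetric]) (use lsp in simp)
    finally have "?min \<le> ?s ls" .
    then show "?min \<le> y" using y by simp
  next
    obtain ls xs where ls: "length ls = i" "length xs = i"
      "\<forall>p<i. ls ! p \<in> {1..Suc m} \<and> xs ! p \<in> Es (ls ! p) x0" "h i xs \<noteq> (\<lambda>I. 0)"
      and cnt: "\<forall>a\<in>{1..Suc m}. card {p. p < i \<and> ls ! p \<le> a} = wedge_rank i (Es a x0)"
      using ex_count_eq_wedge_rank[OF i] by blast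
    have "?s ls = (\<Sum>j=1..m. \<alpha> j * (of_nat i * of_nat (sub_rank X E (Es j))
       - of_nat CARD('r) * of_nat (card {p. p < i \<and> ls ! p \<le> j})))"
      by (rule val) (use ls(3) in simp)
    also have "\<dots> = ?min" by (rule sum.cong[OF refl]) (use cnt in simp)
    finally have eq: "?s ls = ?min" .
    have "?P ls" using ls h_eq_0_iff[OF i, of xs] by (auto simp: set_conv_nth)
    then show "?min \<in> {?s ls | ls. ?P ls}" unfolding eq[symmetric] by blast
  qed
  then have "mu X x0 E m Es \<alpha> i (f i) = - ?min" unfolding mu_def by simp
  then show ?thesis by (simp add: sum_negf[symmetric] right_diff_distrib)
qed

lemma flag_weight_eq:
  fixes E :: "('n::finite, 'e) vbundle"
  assumes E: "smul E = sc" "fibre E x0 = V" "bundle_rank X E = CARD('r)" and x0: "x0 \<in> X"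
    and wf: "weighted_flag X E m Es \<alpha>"
  shows "M_weight X E m Es \<alpha> + \<delta> * mu2 X x0 \<theta> E m Es \<alpha> f = (\<Sum>j=1..m. \<alpha> j *
    (of_int (bundle_degree X E) * of_nat (sub_rank X E (Es j))
      + of_nat CARD('r) * \<delta> * flag_term sc CARD('r) \<theta> k rr W (Es j x0)
      - of_int (sub_degree X E (Es j)) * of_nat CARD('r)))"
proof -
  let ?r = "CARD('r)"
  let ?g = "\<lambda>i j. of_nat ?r * of_nat (wedge_rank i (Es j x0)) - of_nat i * of_nat (sub_rank X E (Es j)) :: rat"
  have "mu2 X x0 \<theta> E m Es \<alpha> f = (\<Sum>i=1..?r. \<Sum>j=1..m. \<alpha> j * (of_nat (\<theta> i) * ?g i j))"
    unfolding mu2_def using mu_eq[OF E x0 wf]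
    by (intro sum.cong refl) (simp add: sum_distrib_left mult_ac)
  also have "\<dots> = (\<Sum>j=1..m. \<alpha> j * (\<Sum>i=1..?r. of_nat (\<theta> i) * ?g i j))"
    unfolding sum_distrib_left by (rule sum.swap)
  also have "\<dots> = (\<Sum>j=1..m. \<alpha> j * (of_nat ?r * flag_term sc ?r \<theta> k rr W (Es j x0)))"
  proof (intro sum.cong refl arg_cong2[of _ _ _ _ "(*)"])
    fix j assume j: "j \<in> {1..m}"
    note sb = weighted_flag_member(1)[OF wf j]
    have "Es j x0 \<subseteq> V" using sb x0 E(2) unfolding subbundle_def by blast
    then show "(\<Sum>i=1..?r. of_nat (\<theta> i) * ?g i j) = of_nat ?r * flag_term sc ?r \<theta> k rr W (Es j x0)"
      using flag_term_eq[of "Es j x0" \<theta>] subbundle_fibre[OF sb x0] E(1) by simp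
  qed
  finally show ?thesis
    unfolding M_weight_def E(3) by (simp add: sum_distrib_left sum.distrib[symmetric] algebra_simps)
qed

end

theorem mainTheorem2:
  fixes X :: "('n::finite) ppoint set" and x0 :: "'n ppoint"
    and E :: "('n, 'e::ab_group_add) vbundle"
    and f :: "('e, 'r::finite) hom_tuple" and l :: "nat \<Rightarrow> complex"
    and \<theta> :: "nat \<Rightarrow> nat" and \<delta>2 :: rat
    and k :: nat and rr :: "nat \<Rightarrow> nat" and W :: "nat \<Rightarrow> 'e set"
    and W' :: "nat \<Rightarrow> (complex ^ 'r) set" and v :: "nat \<Rightarrow> 'e set \<Rightarrow> (complex ^ 'r) set"
    and h :: "('e, 'r) hom_tuple"
  assumes curve: "smooth_projective_curve X" and point: "x0 \<in> X"
    and theta_pos: "\<forall>i\<in>{1..CARD('r)}. \<theta> i > 0" and delta_pos: "\<delta>2 > 0"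
    and vb: "vector_bundle X CARD('r) E"
    and level: "(f, l) \<in> complete_homs (smul E) (fibre E x0)"
    and data: "hom_data (smul E) (fibre E x0) f l k rr W W' v h"
  shows
    "(level_semistable X x0 \<theta> \<delta>2 E f \<longleftrightarrow>
       (\<forall>F. subbundle X E F \<and> strictly_in X (\<lambda>x. {0}) F \<and> strictly_in X F (fibre E) \<longrightarrow>
          of_int (sub_degree X E F) * of_nat CARD('r)
            \<le> of_int (bundle_degree X E) * of_nat (sub_rank X E F)
              + of_nat CARD('r) * \<delta>2 * flag_term (smul E) CARD('r) \<theta> k rr W (F x0))) \<and>
     (level_stable X x0 \<theta> \<delta>2 E f \<longleftrightarrow>
       (\<forall>F. subbundle X E F \<and> strictly_in X (\<lambda>x. {0}) F \<and> strictly_in X F (fibre E) \<longrightarrow>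
          of_int (sub_degree X E F) * of_nat CARD('r)
            < of_int (bundle_degree X E) * of_nat (sub_rank X E F)
              + of_nat CARD('r) * \<delta>2 * flag_term (smul E) CARD('r) \<theta> k rr W (F x0)))"
proof -
  have "vector_space (smul E)" using vb unfolding vector_bundle_def by blast
  with data interpret stratum "smul E" "fibre E x0" f l k rr W W' v h
    by (intro stratum.intro stratum_axioms.intro)
  have rank: "bundle_rank X E = CARD('r)"
    using bundle_rank_eq_dim[OF vb point] dim_fibre[OF vb point] by simp
  define proper where "proper F \<longleftrightarrow>
    subbundle X E F \<and> strictly_in X (\<lambda>x. {0}) F \<and> strictly_in X F (fibre E)" for F
  define N where "N F = of_int (bundle_degree X E) * of_nat (sub_rank X E F)
      + of_nat CARD('r) * \<delta>2 * flag_term (smul E) CARD('r) \<theta> k rr W (F x0)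
      - of_int (sub_degree X E F) * of_nat CARD('r)" for F
  have total: "M_weight X E m Es \<alpha> + \<delta>2 * mu2 X x0 \<theta> E m Es \<alpha> f = (\<Sum>j=1..m. \<alpha> j * N (Es j))"
    if "weighted_flag X E m Es \<alpha>" for m Es \<alpha>
    unfolding N_def by (rule flag_weight_eq[OF refl refl rank point that])
  have member: "proper (Es j) \<and> \<alpha> j > 0" if "weighted_flag X E m Es \<alpha>" "j \<in> {1..m}" for m Es \<alpha> j
    using weighted_flag_member[OF that] unfolding proper_def by blast
  have single: "\<exists>m Es \<alpha>. weighted_flag X E m Es \<alpha> \<and>
      M_weight X E m Es \<alpha> + \<delta>2 * mu2 X x0 \<theta> E m Es \<alpha> f = N F" if "proper F" for F
  proof -
    have wf: "weighted_flag X E 1 (\<lambda>j. if j = 1 then F else fibre E) (\<lambda>_. 1)"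
      using that one_step_flag unfolding proper_def by blast
    then show ?thesis using total[OF wf] by fastforce
  qed
  have "level_semistable X x0 \<theta> \<delta>2 E f \<longleftrightarrow> (\<forall>F. proper F \<longrightarrow> 0 \<le> N F)"
  proof
    assume "level_semistable X x0 \<theta> \<delta>2 E f"
    then show "\<forall>F. proper F \<longrightarrow> 0 \<le> N F" using single unfolding level_semistable_def by metis
  next
    assume N: "\<forall>F. proper F \<longrightarrow> 0 \<le> N F"
    show "level_semistable X x0 \<theta> \<delta>2 E f"
      unfolding level_semistable_def
    proof (intro allI impI)
      fix m Es \<alpha> assume wf: "weighted_flag X E m Es \<alpha>"
      have "0 \<le> (\<Sum>j=1..m. \<alpha> j * N (Es j))"
        by (rule sum_nonneg, rule mult_nonneg_nonneg) (use member[OF wf] N in \<open>auto simp: less_imp_le\<close>)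
      then show "M_weight X E m Es \<alpha> + \<delta>2 * mu2 X x0 \<theta> E m Es \<alpha> f \<ge> 0" using total[OF wf] by simp
    qed
  qed
  moreover have "level_stable X x0 \<theta> \<delta>2 E f \<longleftrightarrow> (\<forall>F. proper F \<longrightarrow> 0 < N F)"
  proof
    assume "level_stable X x0 \<theta> \<delta>2 E f"
    then show "\<forall>F. proper F \<longrightarrow> 0 < N F" using single unfolding level_stable_def by metis
  next
    assume N: "\<forall>F. proper F \<longrightarrow> 0 < N F"
    show "level_stable X x0 \<theta> \<delta>2 E f"
      unfolding level_stable_def
    proof (intro allI impI)
      fix m Es \<alpha> assume wf: "weighted_flag X E m Es \<alpha>"
      then have "m \<ge> 1" unfolding weighted_flag_def by blast
      then have "0 < (\<Sum>j=1..m. \<alpha> j * N (Es j))" using member[OF wf] N by (intro sum_pos) auto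
      then show "M_weight X E m Es \<alpha> + \<delta>2 * mu2 X x0 \<theta> E m Es \<alpha> f > 0" using total[OF wf] by simp
    qed
  qed
  ultimately show ?thesis unfolding proper_def N_def by (simp add: le_diff_eq less_diff_eq)
qed

end
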